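(* Suppose $$\phi(z)=\frac{az+b}{cz+d}$$ is a (nonconstant) linear fractional selfmap of $\mathbb{U}$, and let $\psi=K_{\sigma(0)}$, where $\sigma(z)=(\bar a z-\bar c)/(-\bar b z+\bar d)$. Then $W_{\psi,\phi}$ is normal on $H^2(\mathbb{U})$ if and only if $$\frac{|d|^2}{|d|^2-|b|^2-(\bar b a-\bar d c)z}\,C_{\sigma\circ\phi}=\frac{|d|^2}{|d|^2-|c|^2-(\bar b d-c\bar a)z}\,C_{\phi\circ\sigma}.$$
   Context: $\mathbb{U}$ is the open unit disc in $\mathbb{C}$. $H^2(\mathbb{U})$ is the Hardy space of analytic functions on $\mathbb{U}$ with square-summable Maclaurin coefficients, a Hilbert space with inner product $\langle f,g\rangle=\sum_{n\ge 0}\hat f(n)\overline{\hat g(n)}$, where $\hat f(n)$ are the Maclaurin coefficients. The weighted composition operator is $W_{\psi,\phi}f=\psi\cdot(f\circ\phi)$, and $C_\tau f=f\circ\tau$ for an analytic selfmap $\tau$ of $\mathbb{U}$. A linear fractional selfmap of $\mathbb{U}$ is a map $z\mapsto (az+b)/(cz+d)$ with $a,b,c,d\in\mathbb{C}$, $ad-bc\ne 0$, that maps $\mathbb{U}$ into $\mathbb{U}$; the map $\sigma$ is then also a selfmap of $\mathbb{U}$. For $\beta\in\mathbb{U}$, $K_\beta(z)=1/(1-\bar\beta z)$ is the reproducing kernel of $H^2(\mathbb{U})$ at $\beta$. The displayed equality is an equality of operators on $H^2(\mathbb{U})$: for a function $u$ on $\mathbb{U}$, $u(z)\,C_\tau$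 denotes the operator $f\mapsto u\cdot(f\circ\tau)$. *)

theory Defs
  imports "HOL-Complex_Analysis.Complex_Analysis"
begin

abbreviation unit_disc :: "complex set"  ("\<U>")
  where "\<U> \<equiv> ball 0 1"

definition maclaurin :: "(complex \<Rightarrow> complex) \<Rightarrow> nat \<Rightarrow> complex"
  where "maclaurin f n = fps_nth (fps_expansion f 0) n"

text \<open>
  A function on the disc is represented by the total function that extends it by 0 off the
  disc. So each element of the Hardy space has exactly one representative, and equality
  in HOL is equality of functions on the disc.
\<close>

definition H2 :: "(complex \<Rightarrow> complex) set"
  where "H2 = {f. f holomorphic_on \<U> \<and> summable (\<lambda>n. (cmod (maclaurin f n))\<^sup>2) \<and>
                  (\<forall>z. z \<notin> \<U> \<longrightarrow> f z = 0)}"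

definition H2_inner :: "(complex \<Rightarrow> complex) \<Rightarrow> (complex \<Rightarrow> complex) \<Rightarrow> complex"
  where "H2_inner f g = (\<Sum>n. maclaurin f n * cnj (maclaurin g n))"

definition H2_norm :: "(complex \<Rightarrow> complex) \<Rightarrow> real"
  where "H2_norm f = sqrt (\<Sum>n. (cmod (maclaurin f n))\<^sup>2)"

type_synonym operator = "(complex \<Rightarrow> complex) \<Rightarrow> (complex \<Rightarrow> complex)"

definition bounded_operator_H2 :: "operator \<Rightarrow> bool"
  where "bounded_operator_H2 T \<longleftrightarrow>
    (\<forall>f\<in>H2. T f \<in> H2) \<and>
    (\<forall>f\<in>H2. \<forall>g\<in>H2. T (\<lambda>z. f z + g z) = (\<lambda>z. T f z + T g z)) \<and>
    (\<forall>f\<in>H2. \<forall>k. T (\<lambda>z. k * f z) = (\<lambda>z. k * T f z)) \<and>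
    (\<exists>M. \<forall>f\<in>H2. H2_norm (T f) \<le> M * H2_norm f)"

definition adjoint_H2 :: "operator \<Rightarrow> operator \<Rightarrow> bool"
  where "adjoint_H2 T S \<longleftrightarrow>
    bounded_operator_H2 S \<and> (\<forall>f\<in>H2. \<forall>g\<in>H2. H2_inner (T f) g = H2_inner f (S g))"

text \<open>
  The existential quantifier is harmless: every bounded operator on the Hilbert space
  \<^const>\<open>H2\<close> has an adjoint, which is unique on \<^const>\<open>H2\<close>.
\<close>

definition normal_H2 :: "operator \<Rightarrow> bool"
  where "normal_H2 T \<longleftrightarrow> bounded_operator_H2 T \<and>
    (\<exists>S. adjoint_H2 T S \<and> (\<forall>f\<in>H2. T (S f) = S (T f)))"

text \<open>The operator taking \<open>f\<close> to \<open>u \<cdot> (f \<circ> \<tau>)\<close>; it serves for both \<open>W\<^bsub>u,\<tau>\<^esub>\<close> and \<open>u C\<^bsub>\<tau>\<^esub>\<close>.\<close>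

definition weighted_comp :: "(complex \<Rightarrow> complex) \<Rightarrow> (complex \<Rightarrow> complex) \<Rightarrow> operator"
  where "weighted_comp u \<tau> f = (\<lambda>z. if z \<in> \<U> then u z * f (\<tau> z) else 0)"

definition kernel_H2 :: "complex \<Rightarrow> complex \<Rightarrow> complex"
  where "kernel_H2 \<beta> z = 1 / (1 - cnj \<beta> * z)"

definition linear_fractional :: "complex \<Rightarrow> complex \<Rightarrow> complex \<Rightarrow> complex \<Rightarrow> complex \<Rightarrow> complex"
  where "linear_fractional a b c d z = (a * z + b) / (c * z + d)"

text \<open>
  The condition \<open>c * z + d \<noteq> 0\<close> says that the map has no pole in the disc, where HOL's
  convention \<open>x / 0 = 0\<close> would otherwise give it a value.
\<close>

definition linear_fractional_selfmap :: "complex \<Rightarrow> complex \<Rightarrow> complex \<Rightarrow> complex \<Rightarrow> bool"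
  where "linear_fractional_selfmap a b c d \<longleftrightarrow>
    a * d - b * c \<noteq> 0 \<and>
    (\<forall>z\<in>\<U>. c * z + d \<noteq> 0 \<and> linear_fractional a b c d z \<in> \<U>)"

end

theory Submission
  imports Defs
begin

text \<open>
  Here \<open>\<psi> z = d / (c * z + d)\<close>. Put \<open>W = W\<^bsub>\<psi>,\<phi>\<^esub>\<close> and \<open>S f = cnj d / (- cnj b * z + cnj d) \<cdot> (f \<circ> \<sigma>)\<close>. The
  two displayed operators are \<open>W S\<close> and \<open>S W\<close>, so the theorem says that \<open>S\<close> is the adjoint of \<open>W\<close>.
  Both operators send a reproducing kernel to a multiple of a reproducing kernel, and the
  reproducing property gives \<open>\<langle>W f, g\<rangle> = \<langle>f, S g\<rangle>\<close> for \<open>g\<close> in the span of the kernels.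

  Boundedness also comes from the kernels. For \<open>f\<close> in their span put \<open>x n = \<parallel>(S W)\<^sup>n f\<parallel>\<close>. Since \<open>S W\<close> is
  symmetric on the span, \<open>x\<close> is log-convex. The elementary estimate
  \<open>\<kappa> * (1 - \<bar>z\<bar>) \<le> 1 - \<bar>\<phi> z\<bar>\<close> gives \<open>x n \<le> C * L ^ n\<close> with \<open>L\<close> independent of \<open>f\<close>. Hence
  \<open>x 1 \<le> L * x 0\<close>, and \<open>\<parallel>W f\<parallel>\<^sup>2 = \<langle>f, S W f\<rangle> \<le> L * \<parallel>f\<parallel>\<^sup>2\<close>. The span is dense, so both the bound
  and the adjoint identity extend to the whole Hardy space.
\<close>

section \<open>The Hardy space\<close>

lemma maclaurin_sums:
  assumes "f holomorphic_on \<U>" "z \<in> \<U>"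
  shows "(\<lambda>n. maclaurin f n * z ^ n) sums f z"
  using holomorphic_power_series[OF assms] by (simp add: maclaurin_def fps_expansion_def)

lemma maclaurin_eqI:
  assumes "\<And>z. z \<in> \<U> \<Longrightarrow> (\<lambda>n. a n * z ^ n) sums f z"
  shows "maclaurin f = a"
proof -
  have "f has_fps_expansion Abs_fps a"
    by (rule has_fps_expansionI, rule eventually_nhds_in_open[THEN eventually_mono, of \<U>])
      (use assms in auto)
  then show ?thesis
    by (auto simp: maclaurin_def fun_eq_iff dest: fps_expansion_eqI)
qed

lemma maclaurin_add:
  assumes "f holomorphic_on \<U>" "g holomorphic_on \<U>"
  shows "maclaurin (\<lambda>z. f z + g z) n = maclaurin f n + maclaurin g n"
proof -
  have "maclaurin (\<lambda>z. f z + g z) = (\<lambda>n. maclaurin f n + maclaurin g n)"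
    by (rule maclaurin_eqI)
      (auto simp: distrib_right intro!: sums_add maclaurin_sums assms)
  then show ?thesis by simp
qed

lemma maclaurin_cmult:
  assumes "f holomorphic_on \<U>"
  shows "maclaurin (\<lambda>z. k * f z) n = k * maclaurin f n"
proof -
  have "maclaurin (\<lambda>z. k * f z) = (\<lambda>n. k * maclaurin f n)"
    by (rule maclaurin_eqI)
      (auto simp: mult.assoc intro!: sums_mult maclaurin_sums assms)
  then show ?thesis by simp
qed

lemma maclaurin_diff:
  assumes "f holomorphic_on \<U>" "g holomorphic_on \<U>"
  shows "maclaurin (\<lambda>z. f z - g z) n = maclaurin f n - maclaurin g n"
proof -
  have "maclaurin (\<lambda>z. f z - g z) = (\<lambda>n. maclaurin f n - maclaurin g n)"
    by (rule maclaurin_eqI)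
      (auto simp: left_diff_distrib intro!: sums_diff maclaurin_sums assms)
  then show ?thesis by simp
qed

text \<open>Cauchy's estimate on the circle of radius \<open>r\<close>. It controls single
  coefficients of a function that is not yet known to lie in \<open>H2\<close>.\<close>

lemma maclaurin_bound:
  assumes "f holomorphic_on \<U>" "0 < r" "r < 1" "\<And>z. cmod z = r \<Longrightarrow> cmod (f z) \<le> B"
  shows "cmod (maclaurin f n) \<le> B / r ^ n"
proof -
  have "cball 0 r \<subseteq> \<U>"
    using assms by auto
  then have "cmod ((deriv ^^ n) f 0) \<le> fact n * B / r ^ n"
    using assms
    by (intro Cauchy_inequality)
      (auto intro: holomorphic_on_imp_continuous_on holomorphic_on_subset)
  then show ?thesis
    by (simp add: maclaurin_def fps_expansion_def norm_divide field_simps)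
qed

section \<open>Norm and inner product on square-summable coefficients\<close>

lemma H2D:
  assumes "f \<in> H2"
  shows "f holomorphic_on \<U>" "summable (\<lambda>n. (cmod (maclaurin f n))\<^sup>2)" "z \<notin> \<U> \<Longrightarrow> f z = 0"
  using assms by (auto simp: H2_def)

lemma H2_norm_nonneg: "f \<in> H2 \<Longrightarrow> 0 \<le> H2_norm f"
  by (auto simp: H2_norm_def H2D suminf_nonneg)

lemma L2_set_maclaurin_le:
  assumes "f \<in> H2"
  shows "L2_set (\<lambda>n. cmod (maclaurin f n)) {..<J} \<le> H2_norm f"
  unfolding L2_set_def H2_norm_def
  by (intro real_sqrt_le_mono sum_le_suminf H2D assms) auto

text \<open>A uniform bound on the finite \<open>L2_set\<close> sums passes to the limit. In this
  way the finite-sum inequalities for \<open>L2_set\<close> carry over to whole series.\<close>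

lemma H2I:
  assumes "f holomorphic_on \<U>" "\<And>z. z \<notin> \<U> \<Longrightarrow> f z = 0"
    and "\<And>J. L2_set (\<lambda>n. cmod (maclaurin f n)) {..<J} \<le> C"
  shows "f \<in> H2" "H2_norm f \<le> C"
proof -
  \<comment> \<open>For \<open>J = 0\<close> the index set is empty and its \<open>L2_set\<close> is
    0.\<close>
  have C: "C \<ge> 0"
    using assms(3)[of 0] by simp
  have le: "(\<Sum>n<J. (cmod (maclaurin f n))\<^sup>2) \<le> C\<^sup>2" for J
    using assms(3)[of J] by (simp add: L2_set_def sqrt_le_D)
  then have sm: "summable (\<lambda>n. (cmod (maclaurin f n))\<^sup>2)"
    by (intro summableI_nonneg_bounded) auto
  then show "f \<in> H2"
    using assms by (auto simp: H2_def)
  show "H2_norm f \<le> C"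
    unfolding H2_norm_def using C le sm by (intro real_le_lsqrt suminf_le_const) auto
qed

lemma H2_add:
  assumes "f \<in> H2" "g \<in> H2"
  shows "(\<lambda>z. f z + g z) \<in> H2" "H2_norm (\<lambda>z. f z + g z) \<le> H2_norm f + H2_norm g"
proof -
  have "L2_set (\<lambda>n. cmod (maclaurin (\<lambda>z. f z + g z) n)) {..<J} \<le> H2_norm f + H2_norm g" for J
  proof -
    have "L2_set (\<lambda>n. cmod (maclaurin (\<lambda>z. f z + g z) n)) {..<J}
      \<le> L2_set (\<lambda>n. cmod (maclaurin f n) + cmod (maclaurin g n)) {..<J}"
      using assms by (intro L2_set_mono) (auto simp: maclaurin_add H2D norm_triangle_ineq)
    also have "\<dots> \<le> L2_set (\<lambda>n. cmod (maclaurin f n)) {..<J}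
      + L2_set (\<lambda>n. cmod (maclaurin g n)) {..<J}"
      by (rule L2_set_triangle_ineq)
    finally show ?thesis
      using assms L2_set_maclaurin_le[of f J] L2_set_maclaurin_le[of g J] by linarith
  qed
  then show "(\<lambda>z. f z + g z) \<in> H2" "H2_norm (\<lambda>z. f z + g z) \<le> H2_norm f + H2_norm g"
    using assms by (auto intro!: H2I holomorphic_intros simp: H2D)
qed

lemma H2_cmult:
  assumes "f \<in> H2"
  shows "(\<lambda>z. k * f z) \<in> H2" "H2_norm (\<lambda>z. k * f z) = cmod k * H2_norm f"
proof -
  show "(\<lambda>z. k * f z) \<in> H2"
    using assms
    by (auto simp: H2_def maclaurin_cmult norm_mult power_mult_distrib summable_mult
        intro!: holomorphic_intros)
  show "H2_norm (\<lambda>z. k * f z) = cmod k * H2_norm f"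
    using assms
    by (simp add: H2_norm_def maclaurin_cmult H2D norm_mult power_mult_distrib suminf_mult
        real_sqrt_mult)
qed

lemma H2_zero: "(\<lambda>z. 0) \<in> H2" "H2_norm (\<lambda>z. 0) = 0"
proof -
  have "maclaurin (\<lambda>z. 0) = (\<lambda>n. 0)"
    by (rule maclaurin_eqI) auto
  then show "(\<lambda>z. 0) \<in> H2" "H2_norm (\<lambda>z. 0) = 0"
    by (simp_all add: H2_def H2_norm_def)
qed

lemma H2_diff:
  assumes "f \<in> H2" "g \<in> H2"
  shows "(\<lambda>z. f z - g z) \<in> H2"
  using H2_add(1)[OF assms(1) H2_cmult(1)[OF assms(2), of "-1"]] by simp

lemma H2_norm_diff_commute:
  assumes "f \<in> H2" "g \<in> H2"
  shows "H2_norm (\<lambda>z. f z - g z) = H2_norm (\<lambda>z. g z - f z)"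
  using H2_cmult(2)[OF H2_diff[OF assms], of "-1"] by simp

lemma H2_norm_triangle_sub:
  assumes "f \<in> H2" "g \<in> H2"
  shows "H2_norm f \<le> H2_norm g + H2_norm (\<lambda>z. f z - g z)"
  using H2_add(2)[OF assms(2) H2_diff[OF assms]] by simp

text \<open>Finite Cauchy-Schwarz bounds all partial sums by the same number. The resulting absolute
  convergence justifies the termwise algebra of \<open>H2_inner\<close> below.\<close>

lemma H2_inner_summable:
  assumes "f \<in> H2" "g \<in> H2"
  shows "summable (\<lambda>n. cmod (maclaurin f n * cnj (maclaurin g n)))"
    and "(\<Sum>n. cmod (maclaurin f n * cnj (maclaurin g n))) \<le> H2_norm f * H2_norm g"
proof -
  have le: "(\<Sum>n<J. cmod (maclaurin f n * cnj (maclaurin g n))) \<le> H2_norm f * H2_norm g" for J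
  proof -
    have "(\<Sum>n<J. cmod (maclaurin f n * cnj (maclaurin g n)))
      \<le> L2_set (\<lambda>n. cmod (maclaurin f n)) {..<J} * L2_set (\<lambda>n. cmod (maclaurin g n)) {..<J}"
      using L2_set_mult_ineq[of "\<lambda>n. cmod (maclaurin f n)" "\<lambda>n. cmod (maclaurin g n)" "{..<J}"]
      by (simp add: norm_mult)
    also have "\<dots> \<le> H2_norm f * H2_norm g"
      using assms by (intro mult_mono L2_set_maclaurin_le) (auto simp: H2_norm_nonneg)
    finally show ?thesis .
  qed
  then show sm: "summable (\<lambda>n. cmod (maclaurin f n * cnj (maclaurin g n)))"
    by (intro summableI_nonneg_bounded) auto
  show "(\<Sum>n. cmod (maclaurin f n * cnj (maclaurin g n))) \<le> H2_norm f * H2_norm g"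
    using le sm by (intro suminf_le_const) auto
qed

lemma H2_inner_Cauchy_Schwarz:
  assumes "f \<in> H2" "g \<in> H2"
  shows "cmod (H2_inner f g) \<le> H2_norm f * H2_norm g"
  unfolding H2_inner_def
  using H2_inner_summable[OF assms] summable_norm[of "\<lambda>n. maclaurin f n * cnj (maclaurin g n)"]
  by linarith

lemma H2_inner_add_right:
  assumes "f \<in> H2" "g \<in> H2" "h \<in> H2"
  shows "H2_inner f (\<lambda>z. g z + h z) = H2_inner f g + H2_inner f h"
  using assms H2_inner_summable(1)[THEN summable_norm_cancel]
  by (simp add: H2_inner_def maclaurin_add H2D distrib_left suminf_add)

lemma H2_inner_diff_right:
  assumes "f \<in> H2" "g \<in> H2" "h \<in> H2"
  shows "H2_inner f (\<lambda>z. g z - h z) = H2_inner f g - H2_inner f h"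
  using assms H2_inner_summable(1)[THEN summable_norm_cancel]
  by (simp add: H2_inner_def maclaurin_diff H2D right_diff_distrib suminf_diff)

lemma H2_inner_cmult_right:
  assumes "f \<in> H2" "g \<in> H2"
  shows "H2_inner f (\<lambda>z. k * g z) = cnj k * H2_inner f g"
  using assms H2_inner_summable(1)[THEN summable_norm_cancel]
  by (simp add: H2_inner_def maclaurin_cmult H2D suminf_mult mult.left_commute)

lemma H2_inner_self:
  assumes "f \<in> H2"
  shows "H2_inner f f = complex_of_real ((H2_norm f)\<^sup>2)"
proof -
  have "H2_inner f f = (\<Sum>n. complex_of_real ((cmod (maclaurin f n))\<^sup>2))"
    by (simp add: H2_inner_def complex_norm_square del: of_real_power)
  also have "\<dots> = complex_of_real (\<Sum>n. (cmod (maclaurin f n))\<^sup>2)"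
    using H2D[OF assms] by (simp add: suminf_of_real)
  also have "\<dots> = complex_of_real ((H2_norm f)\<^sup>2)"
    using H2D[OF assms] by (simp add: H2_norm_def suminf_nonneg)
  finally show ?thesis .
qed

lemma H2_inner_commute:
  assumes "f \<in> H2" "g \<in> H2"
  shows "H2_inner g f = cnj (H2_inner f g)"
proof -
  have "(\<lambda>n. maclaurin f n * cnj (maclaurin g n)) sums H2_inner f g"
    unfolding H2_inner_def
    using assms H2_inner_summable(1)[THEN summable_norm_cancel] by blast
  then have "(\<lambda>n. cnj (maclaurin f n * cnj (maclaurin g n))) sums cnj (H2_inner f g)"
    by (simp only: sums_cnj)
  then show ?thesis
    by (auto simp: H2_inner_def sums_iff mult.commute)
qed

section \<open>Reproducing kernels and their span\<close>

text \<open>Elements of \<open>H2\<close> vanish off the disc, which \<open>kernel_H2\<close> itself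
  does not.\<close>

definition H2_kernel :: "complex \<Rightarrow> complex \<Rightarrow> complex"
  where "H2_kernel \<beta> z = (if z \<in> \<U> then kernel_H2 \<beta> z else 0)"

lemma kernel_denominator_nonzero:
  assumes "\<beta> \<in> \<U>" "z \<in> \<U>"
  shows "1 - cnj \<beta> * z \<noteq> 0"
proof
  assume "1 - cnj \<beta> * z = 0"
  then have "cmod \<beta> * cmod z = 1"
    by (metis complex_mod_cnj norm_mult norm_one right_minus_eq)
  with assms show False
    using mult_strict_mono'[of "cmod \<beta>" 1 "cmod z" 1] by simp
qed

lemma maclaurin_H2_kernel:
  assumes "\<beta> \<in> \<U>"
  shows "maclaurin (H2_kernel \<beta>) n = cnj \<beta> ^ n"
proof -
  have "maclaurin (H2_kernel \<beta>) = (\<lambda>n. cnj \<beta> ^ n)"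
  proof (rule maclaurin_eqI)
    fix z assume z: "z \<in> \<U>"
    have "cmod (cnj \<beta> * z) < 1"
      using assms z mult_strict_mono'[of "cmod \<beta>" 1 "cmod z" 1] by (simp add: norm_mult)
    then show "(\<lambda>n. cnj \<beta> ^ n * z ^ n) sums H2_kernel \<beta> z"
      using z geometric_sums[of "cnj \<beta> * z"]
      by (simp add: H2_kernel_def kernel_H2_def power_mult_distrib)
  qed
  then show ?thesis by simp
qed

text \<open>The bound is the sum of the moduli of the coefficients. The exact norm is
  \<open>1 / sqrt (1 - (cmod \<beta>)^2)\<close>, but a power of the distance to the circle is all
  that the later growth estimate uses.\<close>

lemma H2_kernel:
  assumes "\<beta> \<in> \<U>"
  shows "H2_kernel \<beta> \<in> H2" "H2_norm (H2_kernel \<beta>) \<le> 1 / (1 - cmod \<beta>)"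
proof -
  have "L2_set (\<lambda>n. cmod (maclaurin (H2_kernel \<beta>) n)) {..<J} \<le> 1 / (1 - cmod \<beta>)" for J
  proof -
    have "L2_set (\<lambda>n. cmod (maclaurin (H2_kernel \<beta>) n)) {..<J} \<le> (\<Sum>n<J. cmod \<beta> ^ n)"
      using L2_set_le_sum_abs[of "\<lambda>n. cmod \<beta> ^ n" "{..<J}"] assms
      by (simp add: maclaurin_H2_kernel norm_power)
    also have "\<dots> \<le> (\<Sum>n. cmod \<beta> ^ n)"
      using assms by (intro sum_le_suminf summable_geometric) auto
    finally show ?thesis
      using assms by (simp add: suminf_geometric)
  qed
  moreover have "H2_kernel \<beta> holomorphic_on \<U>"
    by (rule holomorphic_transform[of "kernel_H2 \<beta>"])
      (use kernel_denominator_nonzero[OF assms] in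
        \<open>auto simp: H2_kernel_def kernel_H2_def[abs_def] intro!: holomorphic_intros\<close>)
  ultimately show "H2_kernel \<beta> \<in> H2" "H2_norm (H2_kernel \<beta>) \<le> 1 / (1 - cmod \<beta>)"
    by (auto intro!: H2I simp: H2_kernel_def)
qed

text \<open>Reproducing property: the conjugated coefficients of the kernel are the powers of
  \<beta>, so the inner product is the power series of \<open>f\<close> at \<beta>.\<close>

lemma H2_inner_kernel:
  assumes "f \<in> H2" "\<beta> \<in> \<U>"
  shows "H2_inner f (H2_kernel \<beta>) = f \<beta>"
  using maclaurin_sums[of f \<beta>] assms
  by (simp add: H2_inner_def maclaurin_H2_kernel H2D sums_iff)

lemma H2_eval_bound:
  assumes "f \<in> H2" "z \<in> \<U>"
  shows "cmod (f z) \<le> H2_norm f / (1 - cmod z)"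
proof -
  have "cmod (f z) \<le> H2_norm f * H2_norm (H2_kernel z)"
    using H2_inner_Cauchy_Schwarz[OF assms(1) H2_kernel(1)[OF assms(2)]] assms
    by (simp add: H2_inner_kernel)
  also have "\<dots> \<le> H2_norm f * (1 / (1 - cmod z))"
    using H2_kernel(2)[OF assms(2)] assms by (intro mult_left_mono) (auto simp: H2_norm_nonneg)
  finally show ?thesis by simp
qed

text \<open>Each kernel carries its scalar, so inductions have only two cases; the zero function
  arises from \<open>k = 0\<close>.\<close>

inductive_set kernel_span :: "(complex \<Rightarrow> complex) set" where
  scaled_kernel: "\<beta> \<in> \<U> \<Longrightarrow> (\<lambda>z. k * H2_kernel \<beta> z) \<in> kernel_span"
| add: "f \<in> kernel_span \<Longrightarrow> g \<in> kernel_span \<Longrightarrow> (\<lambda>z. f z + g z) \<in> kernel_span"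

lemma kernel_span_subset_H2: "kernel_span \<subseteq> H2"
proof
  show "f \<in> H2" if "f \<in> kernel_span" for f
    using that by induction (use H2_kernel in \<open>auto intro: H2_add H2_cmult\<close>)
qed

lemma kernel_span_cmult:
  assumes "f \<in> kernel_span"
  shows "(\<lambda>z. c * f z) \<in> kernel_span"
  using assms
proof induction
  case (scaled_kernel \<beta> k)
  then show ?case
    using kernel_span.scaled_kernel[of \<beta> "c * k"] by (simp add: mult.assoc)
next
  case (add f g)
  then show ?case
    using kernel_span.add by (simp add: distrib_left)
qed

section \<open>Density of the kernel span in the Hardy space\<close>

definition kernel_closure :: "(complex \<Rightarrow> complex) set"
  where "kernel_closure =
    {f \<in> H2. \<forall>e>0. \<exists>g\<in>kernel_span. H2_norm (\<lambda>z. f z - g z) < e}"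

lemma kernel_span_subset_closure: "kernel_span \<subseteq> kernel_closure"
proof
  fix f assume "f \<in> kernel_span"
  then show "f \<in> kernel_closure"
    using kernel_span_subset_H2 H2_zero(2) by (auto simp: kernel_closure_def intro!: bexI[of _ f])
qed

lemma kernel_closureE:
  assumes "f \<in> kernel_closure" "e > 0"
  obtains g where "g \<in> kernel_span" "g \<in> H2" "H2_norm (\<lambda>z. f z - g z) < e"
  using assms kernel_span_subset_H2 unfolding kernel_closure_def by blast

lemma kernel_closure_add:
  assumes "f \<in> kernel_closure" "g \<in> kernel_closure"
  shows "(\<lambda>z. f z + g z) \<in> kernel_closure"
  unfolding kernel_closure_def
proof (intro CollectI conjI allI impI)
  have fg: "f \<in> H2" "g \<in> H2"
    using assms by (auto simp: kernel_closure_def)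
  then show "(\<lambda>z. f z + g z) \<in> H2"
    by (rule H2_add)
  fix e :: real assume "e > 0"
  then have e2: "e / 2 > 0"
    by simp
  obtain f' where f': "f' \<in> kernel_span" "f' \<in> H2" "H2_norm (\<lambda>z. f z - f' z) < e / 2"
    using kernel_closureE[OF assms(1) e2] .
  obtain g' where g': "g' \<in> kernel_span" "g' \<in> H2" "H2_norm (\<lambda>z. g z - g' z) < e / 2"
    using kernel_closureE[OF assms(2) e2] .
  have eq: "(\<lambda>z. f z + g z - (f' z + g' z)) = (\<lambda>z. (f z - f' z) + (g z - g' z))"
    by (simp add: algebra_simps)
  have "H2_norm (\<lambda>z. f z + g z - (f' z + g' z)) < e"
    unfolding eq using H2_add(2)[OF H2_diff[OF fg(1) f'(2)] H2_diff[OF fg(2) g'(2)]] f'(3) g'(3)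
    by linarith
  then show "\<exists>h\<in>kernel_span. H2_norm (\<lambda>z. f z + g z - h z) < e"
    by (rule bexI[OF _ kernel_span.add[OF f'(1) g'(1)]])
qed

lemma kernel_closure_cmult:
  assumes "f \<in> kernel_closure"
  shows "(\<lambda>z. c * f z) \<in> kernel_closure"
  unfolding kernel_closure_def
proof (intro CollectI conjI allI impI)
  have f: "f \<in> H2"
    using assms by (auto simp: kernel_closure_def)
  then show "(\<lambda>z. c * f z) \<in> H2"
    by (rule H2_cmult)
  fix e :: real assume "e > 0"
  \<comment> \<open>The added 1 keeps the divisor positive when \<open>c = 0\<close>.\<close>
  then have "e / (cmod c + 1) > 0"
    by (smt (verit) divide_pos_pos norm_ge_zero)
  then obtain f' where *: "f' \<in> kernel_span" "H2_norm (\<lambda>z. f z - f' z) < e / (cmod c + 1)"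
    using assms unfolding kernel_closure_def by blast
  have "H2_norm (\<lambda>z. c * f z - c * f' z) = cmod c * H2_norm (\<lambda>z. f z - f' z)"
    using H2_cmult(2)[of "\<lambda>z. f z - f' z" c] * f kernel_span_subset_H2 H2_diff
    by (auto simp: right_diff_distrib)
  also have "\<dots> \<le> (cmod c + 1) * H2_norm (\<lambda>z. f z - f' z)"
    using * f kernel_span_subset_H2 H2_diff by (intro mult_right_mono H2_norm_nonneg) auto
  also have "\<dots> < e"
    using * by (subst mult.commute) (simp add: pos_less_divide_eq add_nonneg_pos)
  finally show "\<exists>h\<in>kernel_span. H2_norm (\<lambda>z. c * f z - h z) < e"
    by (rule bexI[OF _ kernel_span_cmult[OF *(1)]])
qed

text \<open>A closure is closed. Density is then reached in stages: a kernel and the lower monomials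
  give the next monomial, and polynomials give every element of \<open>H2\<close>.\<close>

lemma kernel_closure_limit:
  assumes "f \<in> H2" "\<And>e. e > 0 \<Longrightarrow> \<exists>g\<in>kernel_closure. H2_norm (\<lambda>z. f z - g z) < e"
  shows "f \<in> kernel_closure"
  unfolding kernel_closure_def
proof (intro CollectI conjI allI impI assms)
  fix e :: real assume "e > 0"
  then have e2: "e / 2 > 0"
    by simp
  then obtain g where g: "g \<in> kernel_closure" "H2_norm (\<lambda>z. f z - g z) < e / 2"
    using assms(2) by blast
  obtain h where h: "h \<in> kernel_span" "h \<in> H2" "H2_norm (\<lambda>z. g z - h z) < e / 2"
    using kernel_closureE[OF g(1) e2] .
  have "g \<in> H2"
    using g by (simp add: kernel_closure_def)
  then have "H2_norm (\<lambda>z. f z - h z) < e"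
    using H2_add(2)[OF H2_diff[OF assms(1)] H2_diff[OF _ h(2)], of g g] g(2) h(3) by simp
  then show "\<exists>h\<in>kernel_span. H2_norm (\<lambda>z. f z - h z) < e"
    using h(1) by blast
qed

definition H2_monom :: "nat \<Rightarrow> complex \<Rightarrow> complex"
  where "H2_monom n z = (if z \<in> \<U> then z ^ n else 0)"

lemma maclaurin_H2_monom: "maclaurin (H2_monom n) m = (if m = n then 1 else 0)"
proof -
  have "maclaurin (H2_monom n) = (\<lambda>m. if m = n then 1 else 0)"
  proof (rule maclaurin_eqI)
    fix z assume "z \<in> \<U>"
    then show "(\<lambda>m. (if m = n then 1 else 0) * z ^ m) sums H2_monom n z"
      using sums_single[of n "\<lambda>m. z ^ m"] by (simp add: H2_monom_def if_distrib[of "\<lambda>x. x * _"] cong: if_cong)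
  qed
  then show ?thesis by simp
qed

lemma H2_monom: "H2_monom n \<in> H2"
proof -
  have "H2_monom n holomorphic_on \<U>"
    by (rule holomorphic_transform[of "\<lambda>z. z ^ n"])
      (auto simp: H2_monom_def intro!: holomorphic_intros)
  moreover have "summable (\<lambda>m. (cmod (maclaurin (H2_monom n) m))\<^sup>2)"
    by (rule summable_finite[of "{n}"]) (auto simp: maclaurin_H2_monom)
  ultimately show ?thesis
    by (auto simp: H2_def H2_monom_def)
qed

lemma H2_sum:
  assumes "\<And>i. i \<in> I \<Longrightarrow> f i \<in> H2"
  shows "(\<lambda>z. \<Sum>i\<in>I. f i z) \<in> H2"
  using assms by (induction I rule: infinite_finite_induct) (auto intro: H2_zero H2_add)

lemma kernel_closure_sum:
  assumes "\<And>i. i \<in> I \<Longrightarrow> f i \<in> kernel_closure"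
  shows "(\<lambda>z. \<Sum>i\<in>I. f i z) \<in> kernel_closure"
proof -
  \<comment> \<open>The zero function, as 0 times the kernel at 0, covers the empty sum and also
    infinite \<open>I\<close>, where the sum is 0 by convention.\<close>
  have "(\<lambda>z. 0) \<in> kernel_closure"
    using kernel_span.scaled_kernel[of 0 0] kernel_span_subset_closure by auto
  then show ?thesis
    using assms by (induction I rule: infinite_finite_induct) (auto intro: kernel_closure_add)
qed

lemma maclaurin_sum_monom:
  "maclaurin (\<lambda>z. \<Sum>j<J. c j * H2_monom j z) m = (if m < J then c m else 0)"
proof (induction J)
  case 0
  have "maclaurin (\<lambda>z. 0) = (\<lambda>n. 0)"
    by (rule maclaurin_eqI) auto
  then show ?case by simp
next
  case (Suc J)
  have "(\<lambda>z. \<Sum>j<J. c j * H2_monom j z) \<in> H2" "(\<lambda>z. c J * H2_monom J z) \<in> H2"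
    by (auto intro!: H2_sum H2_cmult H2_monom)
  then show ?case
    using Suc by (auto simp: maclaurin_add maclaurin_cmult maclaurin_H2_monom H2D H2_monom less_Suc_eq)
qed

text \<open>
  The quotient \<open>(K\<^sub>\<beta> - (\<Sum>j<n. \<beta> ^ j * z ^ j)) / \<beta> ^ n\<close> tends to \<open>z ^ n\<close> as \<open>\<beta>\<close> tends to 0
  along the positive reals.
\<close>

lemma H2_monom_in_kernel_closure: "H2_monom n \<in> kernel_closure"
proof (induction n rule: less_induct)
  case (less n)
  show ?case
  proof (rule kernel_closure_limit[OF H2_monom])
    fix e :: real assume e: "e > 0"
    \<comment> \<open>With \<open>b \<le> 1/2\<close> the geometric tail sums to at most
      \<open>2 * b\<close>, and \<open>b \<le> e / 4\<close> makes this at most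
      \<open>e / 2\<close>.\<close>
    define b where "b = min (1/2) (e / 4)"
    have b: "0 < b" "b \<le> 1/2" "b \<le> e / 4"
      using e by (auto simp: b_def)
    define \<beta> where "\<beta> = complex_of_real b"
    have \<beta>: "\<beta> \<in> \<U>" "\<beta> \<noteq> 0" "cnj \<beta> = \<beta>" "cmod \<beta> = b"
      using b by (auto simp: \<beta>_def)
    \<comment> \<open>\<open>P\<close> removes the first \<open>n\<close> Taylor terms of the
      kernel; it lies in the closure by the induction hypothesis for the lower monomials.\<close>
    define P where "P = (\<lambda>z. \<Sum>j<n. - (\<beta> ^ j) * H2_monom j z)"
    define g where "g = (\<lambda>z. (1 / \<beta> ^ n) * (H2_kernel \<beta> z + P z))"
    have P: "P \<in> kernel_closure"
      unfolding P_def using less by (intro kernel_closure_sum kernel_closure_cmult) auto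
    have k: "H2_kernel \<beta> \<in> kernel_closure"
      using kernel_span.scaled_kernel[OF \<beta>(1), of 1] kernel_span_subset_closure by auto
    have g: "g \<in> kernel_closure"
      unfolding g_def using P k by (intro kernel_closure_cmult kernel_closure_add)
    have H2: "P \<in> H2" "H2_kernel \<beta> \<in> H2" "g \<in> H2"
      using P k g by (auto simp: kernel_closure_def)
    have kP: "(\<lambda>z. H2_kernel \<beta> z + P z) \<in> H2"
      by (intro H2_add H2)
    have mP: "maclaurin P m = (if m < n then - (\<beta> ^ m) else 0)" for m
      unfolding P_def by (rule maclaurin_sum_monom)
    have mg: "maclaurin g m = (if m < n then 0 else \<beta> ^ (m - n))" for m
    proof -
      have "maclaurin g m = (1 / \<beta> ^ n) * (\<beta> ^ m + (if m < n then - (\<beta> ^ m) else 0))"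
        unfolding g_def maclaurin_cmult[OF H2D(1)[OF kP]]
          maclaurin_add[OF H2D(1)[OF H2(2)] H2D(1)[OF H2(1)]] mP maclaurin_H2_kernel[OF \<beta>(1)] \<beta>(3) ..
      then show ?thesis
        using \<beta> by (simp add: power_diff)
    qed
    define D where "D = (\<lambda>z. H2_monom n z - g z)"
    have D: "D \<in> H2"
      unfolding D_def by (intro H2_diff H2_monom H2)
    \<comment> \<open>At \<open>m = n\<close> the coefficient of \<open>g\<close> is
      \<open>\<beta> ^ 0 = 1\<close> and cancels that of the monomial, so \<open>m < n\<close> in
      \<open>mg\<close> becomes \<open>m \<le> n\<close> here.\<close>
    have mD: "cmod (maclaurin D m) \<le> (if m \<le> n then 0 else b ^ (m - n))" for m
      unfolding D_def using H2D(1)[OF H2_monom] H2D(1)[OF H2(3)]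
      by (auto simp: maclaurin_diff mg maclaurin_H2_monom norm_power \<beta>)
    have "L2_set (\<lambda>m. cmod (maclaurin D m)) {..<J} \<le> 2 * b" for J
    proof -
      have "L2_set (\<lambda>m. cmod (maclaurin D m)) {..<J} \<le> (\<Sum>m<J. cmod (maclaurin D m))"
        using L2_set_le_sum_abs[of "\<lambda>m. cmod (maclaurin D m)" "{..<J}"] by simp
      also have "\<dots> \<le> (\<Sum>m<J. if m \<le> n then 0 else b ^ (m - n))"
        by (intro sum_mono mD)
      also have "\<dots> = (\<Sum>m\<in>{Suc n..<J}. b ^ (m - n))"
        by (intro sum.mono_neutral_cong_right) auto
      also have "\<dots> = (\<Sum>i<J - Suc n. b * b ^ i)"
        by (rule sum.reindex_bij_witness[of _ "\<lambda>i. i + Suc n" "\<lambda>m. m - Suc n"])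
          (auto simp: Suc_diff_Suc simp flip: power_Suc)
      also have "\<dots> = b * (\<Sum>i<J - Suc n. b ^ i)"
        by (simp add: sum_distrib_left)
      also have "\<dots> \<le> b * (\<Sum>i. b ^ i)"
        using b by (intro mult_left_mono sum_le_suminf summable_geometric) auto
      also have "\<dots> = b * (1 / (1 - b))"
        using b by (simp add: suminf_geometric)
      also have "\<dots> \<le> b * 2"
        using b by (intro mult_left_mono) (auto simp: field_simps)
      finally show ?thesis by simp
    qed
    then have "H2_norm D \<le> 2 * b"
      by (intro H2I(2) H2D[OF D])
    then have "H2_norm (\<lambda>z. H2_monom n z - g z) < e"
      using b e unfolding D_def by linarith
    then show "\<exists>g\<in>kernel_closure. H2_norm (\<lambda>z. H2_monom n z - g z) < e"
      using g by blast
  qed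
qed

text \<open>Taylor polynomials approximate \<open>f\<close> because the tail of a convergent series
  of squares is small, and they lie in the closure by the result on monomials.\<close>

lemma H2_kernel_closure:
  assumes f: "f \<in> H2"
  shows "f \<in> kernel_closure"
proof (rule kernel_closure_limit[OF f])
  fix e :: real assume e: "e > 0"
  define a where "a n = (cmod (maclaurin f n))\<^sup>2" for n
  have a: "summable a" "\<And>n. a n \<ge> 0"
    using H2D(2)[OF f] by (auto simp: a_def[abs_def])
  \<comment> \<open>Squared because the norm is the root of the tail; halved because the bound on
    partial sums becomes non-strict in the limit.\<close>
  have "(e/2)\<^sup>2 > 0"
    using e by auto
  then obtain N where "\<forall>m\<ge>N. \<forall>n. norm (sum a {m..<n}) < (e/2)\<^sup>2"
    using a(1) unfolding summable_Cauchy by blast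
  then have N: "(\<Sum>n\<in>{N..<J}. a n) < (e/2)\<^sup>2" for J
    using a(2) by (metis abs_of_nonneg order_refl real_norm_def sum_nonneg)
  define g where "g = (\<lambda>z. \<Sum>j<N. maclaurin f j * H2_monom j z)"
  have g: "g \<in> kernel_closure"
    unfolding g_def by (intro kernel_closure_sum kernel_closure_cmult H2_monom_in_kernel_closure)
  then have gH2: "g \<in> H2"
    by (simp add: kernel_closure_def)
  define D where "D = (\<lambda>z. f z - g z)"
  have D: "D \<in> H2"
    unfolding D_def by (intro H2_diff f gH2)
  have mg: "maclaurin g m = (if m < N then maclaurin f m else 0)" for m
    unfolding g_def by (rule maclaurin_sum_monom)
  have mD: "maclaurin D m = (if m < N then 0 else maclaurin f m)" for m
    unfolding D_def using H2D(1)[OF f] H2D(1)[OF gH2] by (simp add: maclaurin_diff mg)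
  have "L2_set (\<lambda>m. cmod (maclaurin D m)) {..<J} \<le> e / 2" for J
  proof -
    have "(\<Sum>m<J. (cmod (maclaurin D m))\<^sup>2) = (\<Sum>n\<in>{N..<J}. a n)"
      by (intro sum.mono_neutral_cong_right) (auto simp: mD a_def)
    then show ?thesis
      using N[of J] e unfolding L2_set_def by (intro real_le_lsqrt) auto
  qed
  then have "H2_norm D \<le> e / 2"
    by (intro H2I(2) H2D[OF D])
  then show "\<exists>g\<in>kernel_closure. H2_norm (\<lambda>z. f z - g z) < e"
    using g e unfolding D_def by (intro bexI[of _ g]) auto
qed

section \<open>Linear fractional selfmaps\<close>

lemma linear_fractional_selfmapD:
  assumes "linear_fractional_selfmap a b c d"
  shows "a * d - b * c \<noteq> 0"
    and "z \<in> \<U> \<Longrightarrow> c * z + d \<noteq> 0"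
    and "z \<in> \<U> \<Longrightarrow> linear_fractional a b c d z \<in> \<U>"
    and "z \<in> \<U> \<Longrightarrow> cmod (a * z + b) < cmod (c * z + d)"
proof -
  show "a * d - b * c \<noteq> 0" and *: "z \<in> \<U> \<Longrightarrow> c * z + d \<noteq> 0"
    and **: "z \<in> \<U> \<Longrightarrow> linear_fractional a b c d z \<in> \<U>"
    using assms by (auto simp: linear_fractional_selfmap_def)
  show "z \<in> \<U> \<Longrightarrow> cmod (a * z + b) < cmod (c * z + d)"
    using * ** by (simp add: linear_fractional_def norm_divide divide_simps split: if_splits)
qed

text \<open>The inequality extends to the closure by continuity. A zero of the denominator would
  therefore be a zero of the numerator too, which the determinant excludes.\<close>

lemma linear_fractional_selfmap_closed_disc:
  assumes "linear_fractional_selfmap a b c d" "cmod w \<le> 1"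
  shows "cmod (a * w + b) \<le> cmod (c * w + d)" "c * w + d \<noteq> 0"
proof -
  have "closed {w. cmod (a * w + b) \<le> cmod (c * w + d)}"
    by (intro closed_Collect_le continuous_intros)
  moreover have "\<U> \<subseteq> {w. cmod (a * w + b) \<le> cmod (c * w + d)}"
    using linear_fractional_selfmapD(4)[OF assms(1)] by (auto intro: less_imp_le)
  ultimately have "closure \<U> \<subseteq> {w. cmod (a * w + b) \<le> cmod (c * w + d)}"
    by (intro closure_minimal)
  then show le: "cmod (a * w + b) \<le> cmod (c * w + d)"
    using assms(2) by auto
  show "c * w + d \<noteq> 0"
  proof
    assume "c * w + d = 0"
    moreover from this le have "a * w + b = 0"
      by simp
    ultimately have "a * (c * w + d) - c * (a * w + b) = 0"
      by simp
    then show False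
      using linear_fractional_selfmapD(1)[OF assms(1)] by (simp add: algebra_simps)
  qed
qed

text \<open>The first inequality says that 0 is mapped into the disc; if the second failed, the pole
  \<open>- d / c\<close> would lie in the closed disc.\<close>

lemma linear_fractional_selfmap_norm_less:
  assumes "linear_fractional_selfmap a b c d"
  shows "cmod b < cmod d" "cmod c < cmod d"
proof -
  show bd: "cmod b < cmod d"
    using linear_fractional_selfmapD(4)[OF assms, of 0] by simp
  show "cmod c < cmod d"
  proof (rule ccontr)
    assume "\<not> cmod c < cmod d"
    then have "c \<noteq> 0" "cmod (- d / c) \<le> 1"
      using bd by (auto simp: norm_divide divide_simps)
    then show False
      using linear_fractional_selfmap_closed_disc(2)[OF assms, of "- d / c"] by simp
  qed
qed

text \<open>
  If \<open>cnj w * \<sigma> z = 1\<close> then \<open>cnj (c * w + d) = cnj (a * w + b) * z\<close>, which is impossible for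
  \<open>cmod w \<le> 1\<close> and \<open>cmod z < 1\<close>.
\<close>

lemma linear_fractional_selfmap_dual:
  assumes "linear_fractional_selfmap a b c d"
  shows "linear_fractional_selfmap (cnj a) (- cnj c) (- cnj b) (cnj d)"
  unfolding linear_fractional_selfmap_def
proof (intro conjI ballI)
  show "cnj a * cnj d - - cnj c * - cnj b \<noteq> 0"
  proof
    assume "cnj a * cnj d - - cnj c * - cnj b = 0"
    then have "cnj (a * d - b * c) = 0"
      by (simp add: mult.commute)
    then show False
      using linear_fractional_selfmapD(1)[OF assms] by (simp only: complex_cnj_zero_iff)
  qed
  fix z assume z: "z \<in> \<U>"
  show nz: "- cnj b * z + cnj d \<noteq> 0"
  proof
    assume "- cnj b * z + cnj d = 0"
    then have "cmod d = cmod b * cmod z"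
      by (metis add_minus_cancel add_0_right complex_mod_cnj minus_mult_left norm_mult)
    also have "\<dots> \<le> cmod b"
      using z by (simp add: mult_left_le)
    finally show False
      using linear_fractional_selfmap_norm_less(1)[OF assms] by simp
  qed
  show "linear_fractional (cnj a) (- cnj c) (- cnj b) (cnj d) z \<in> \<U>"
  proof (rule ccontr)
    define s where "s = linear_fractional (cnj a) (- cnj c) (- cnj b) (cnj d) z"
    assume "linear_fractional (cnj a) (- cnj c) (- cnj b) (cnj d) z \<notin> \<U>"
    then have s: "cmod s \<ge> 1"
      by (simp add: s_def)
    \<comment> \<open>The reflection of \<open>s\<close> in the unit circle, which lies in the
      closed disc.\<close>
    define w where "w = 1 / cnj s"
    have w: "cmod w \<le> 1" "cnj w * s = 1"
      using s by (auto simp: w_def norm_divide divide_le_eq)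
    have "s * (- cnj b * z + cnj d) = cnj a * z - cnj c"
      using nz by (simp add: s_def linear_fractional_def)
    then have "- cnj b * z + cnj d = cnj w * (cnj a * z - cnj c)"
      using w(2) by (metis mult.assoc mult_1)
    then have eq: "cnj (c * w + d) = cnj (a * w + b) * z"
      by (simp add: algebra_simps)
    have "cmod (c * w + d) = cmod (a * w + b) * cmod z"
      using arg_cong[OF eq, of cmod] by (simp only: complex_mod_cnj norm_mult)
    also have "\<dots> \<le> cmod (c * w + d) * cmod z"
      using linear_fractional_selfmap_closed_disc(1)[OF assms w(1)] by (intro mult_right_mono) auto
    also have "\<dots> < cmod (c * w + d)"
      using linear_fractional_selfmap_closed_disc(2)[OF assms w(1)] z by simp
    finally show False by simp
  qed
qed

text \<open>
  With \<open>u\<close> the unit vector along \<open>\<phi> z\<close>, the numerator of \<open>1 - cnj u * \<phi> z\<close> is an affine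
  function of \<open>z\<close> without zeros in the disc.
\<close>

lemma linear_fractional_selfmap_distance:
  assumes "linear_fractional_selfmap a b c d"
  obtains \<kappa> where "\<kappa> > 0"
    "\<And>z. z \<in> \<U> \<Longrightarrow> \<kappa> * (1 - cmod z) \<le> 1 - cmod (linear_fractional a b c d z)"
proof
  note less = linear_fractional_selfmap_norm_less[OF assms]
  have cd: "cmod c + cmod d > 0"
    using less norm_ge_zero[of c] by linarith
  \<comment> \<open>The numerator bounds \<open>cmod (d - u * b)\<close> from below for every unit
    \<open>u\<close>; the denominator bounds \<open>cmod (c * z + d)\<close> from above on the
    disc.\<close>
  show "(cmod d - cmod b) / (cmod c + cmod d) > 0"
    using less cd by simp
  fix z assume z: "z \<in> \<U>"
  define p where "p = linear_fractional a b c d z"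
  have p: "cmod p < 1"
    using linear_fractional_selfmapD(3)[OF assms z] by (simp add: p_def)
  have nz: "c * z + d \<noteq> 0"
    by (rule linear_fractional_selfmapD(2)[OF assms z])
  \<comment> \<open>In the code \<open>u\<close> is the conjugate of the direction of
    \<open>p\<close>, so that \<open>u * p\<close> is real and nonnegative; for \<open>p = 0\<close>
    the choice is 1.\<close>
  obtain u where u: "cmod u = 1" "u * p = complex_of_real (cmod p)"
  proof (cases "p = 0")
    case True
    then show ?thesis using that[of 1] by simp
  next
    case False
    have "cnj p / complex_of_real (cmod p) * p = complex_of_real (cmod p)"
      using False complex_norm_square[of p] by (simp add: power2_eq_square mult.commute divide_eq_eq)
    then show ?thesis
      using that[of "cnj p / complex_of_real (cmod p)"] False by (simp add: norm_divide)
  qed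
  \<comment> \<open>Otherwise the affine function \<open>(d - u * b) + (c - u * a) * w\<close>
    vanishes at a point of the disc, where numerator and denominator of the map have equal
    modulus.\<close>
  have le: "cmod (c - u * a) \<le> cmod (d - u * b)"
  proof (rule ccontr)
    assume *: "\<not> ?thesis"
    define w where "w = - (d - u * b) / (c - u * a)"
    have nz: "c - u * a \<noteq> 0"
      using * by (metis norm_ge_zero norm_zero)
    have "w \<in> \<U>"
      using * nz by (simp add: w_def norm_divide norm_minus_commute)
    moreover have "w * (c - u * a) = - (d - u * b)"
      using nz by (simp add: w_def)
    then have "c * w + d = u * (a * w + b)"
      by (simp add: algebra_simps)
    ultimately show False
      using linear_fractional_selfmapD(4)[OF assms, of w] u(1) by (simp add: norm_mult)
  qed
  have "p * (c * z + d) = a * z + b"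
    using nz by (simp add: p_def linear_fractional_def)
  moreover have "complex_of_real (1 - cmod p) * (c * z + d) = c * z + d - u * (p * (c * z + d))"
    using u(2) by (simp add: left_diff_distrib flip: mult.assoc)
  ultimately have "complex_of_real (1 - cmod p) * (c * z + d) = (d - u * b) + (c - u * a) * z"
    by (simp add: algebra_simps)
  then have "(1 - cmod p) * cmod (c * z + d) = cmod ((d - u * b) + (c - u * a) * z)"
    using p by (metis abs_of_pos diff_gt_0_iff_gt norm_mult norm_of_real)
  \<comment> \<open>By \<open>le\<close> this lower bound is at least
    \<open>cmod (d - u * b) * (1 - cmod z)\<close>, and \<open>cmod (d - u * b)\<close> is at least
    \<open>cmod d - cmod b\<close>.\<close>
  also have "\<dots> \<ge> cmod (d - u * b) - cmod (c - u * a) * cmod z"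
    by (metis norm_diff_ineq norm_mult)
  finally have "(1 - cmod p) * cmod (c * z + d) \<ge> cmod (d - u * b) - cmod (c - u * a) * cmod z" .
  moreover have "cmod (c - u * a) * cmod z \<le> cmod (d - u * b) * cmod z"
    using le by (intro mult_right_mono) auto
  moreover have "cmod (d - u * b) * (1 - cmod z) \<ge> (cmod d - cmod b) * (1 - cmod z)"
    using z norm_triangle_ineq2[of d "u * b"] u(1) by (intro mult_right_mono) (auto simp: norm_mult)
  ultimately have "(cmod d - cmod b) * (1 - cmod z) \<le> (1 - cmod p) * cmod (c * z + d)"
    by (simp add: algebra_simps)
  also have "\<dots> \<le> (1 - cmod p) * (cmod c + cmod d)"
  proof (intro mult_left_mono)
    have "cmod (c * z + d) \<le> cmod c * cmod z + cmod d"
      by (metis norm_mult norm_triangle_ineq)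
    also have "\<dots> \<le> cmod c + cmod d"
      using z by (simp add: mult_left_le)
    finally show "cmod (c * z + d) \<le> cmod c + cmod d" .
  qed (use p in auto)
  finally show "(cmod d - cmod b) / (cmod c + cmod d) * (1 - cmod z)
      \<le> 1 - cmod (linear_fractional a b c d z)"
    using cd by (simp add: p_def field_simps)
qed

section \<open>The weighted composition operator and its adjoint\<close>

lemma weighted_comp_add:
  "weighted_comp u \<tau> (\<lambda>z. f z + g z) = (\<lambda>z. weighted_comp u \<tau> f z + weighted_comp u \<tau> g z)"
  by (auto simp: weighted_comp_def distrib_left)

lemma weighted_comp_cmult:
  "weighted_comp u \<tau> (\<lambda>z. k * f z) = (\<lambda>z. k * weighted_comp u \<tau> f z)"
  by (auto simp: weighted_comp_def)

text \<open>The weight is the kernel at \<open>\<sigma> 0 = - cnj c / cnj d\<close>. Indexing by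
  coefficients puts the operator and its adjoint in one family.\<close>

definition lf_op :: "complex \<Rightarrow> complex \<Rightarrow> complex \<Rightarrow> complex \<Rightarrow> operator"
  where "lf_op a b c d = weighted_comp (\<lambda>z. d / (c * z + d)) (linear_fractional a b c d)"

text \<open>The coefficients are those of \<sigma>. The passage from \<phi> to \<sigma> is an
  involution, so each fact about \<open>lf_op\<close> also serves \<open>lf_adj\<close>, with the
  roles exchanged.\<close>

abbreviation lf_adj :: "complex \<Rightarrow> complex \<Rightarrow> complex \<Rightarrow> complex \<Rightarrow> operator"
  where "lf_adj a b c d \<equiv> lf_op (cnj a) (- cnj c) (- cnj b) (cnj d)"

lemma lf_op_add: "lf_op a b c d (\<lambda>z. f z + g z) = (\<lambda>z. lf_op a b c d f z + lf_op a b c d g z)"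
  by (simp add: lf_op_def weighted_comp_add)

lemma lf_op_cmult: "lf_op a b c d (\<lambda>z. k * f z) = (\<lambda>z. k * lf_op a b c d f z)"
  by (simp add: lf_op_def weighted_comp_cmult)

lemma lf_op_diff: "lf_op a b c d (\<lambda>z. f z - g z) = (\<lambda>z. lf_op a b c d f z - lf_op a b c d g z)"
  using lf_op_add[of a b c d f "\<lambda>z. - 1 * g z"] lf_op_cmult[of a b c d "- 1" g] by simp

lemma lf_op_apply:
  "z \<in> \<U> \<Longrightarrow> lf_op a b c d f z = d / (c * z + d) * f (linear_fractional a b c d z)"
  "z \<notin> \<U> \<Longrightarrow> lf_op a b c d f z = 0"
  by (simp_all add: lf_op_def weighted_comp_def)

lemma cmod_divide_affine_le:
  assumes "cmod c < cmod d" "cmod z < 1"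
  shows "cmod (d / (c * z + d)) \<le> cmod d / (cmod d - cmod c)"
proof -
  have "cmod c * cmod z \<le> cmod c"
    using assms by (simp add: mult_left_le)
  moreover have "cmod d - cmod (c * z) \<le> cmod (c * z + d)"
    by (metis add.commute norm_diff_ineq)
  ultimately have "cmod d - cmod c \<le> cmod (c * z + d)"
    by (simp add: norm_mult)
  then show ?thesis
    using assms by (simp add: norm_divide frac_le)
qed

text \<open>Rests on the identity \<open>(c * z + d) * (1 - cnj \<beta> * \<phi> z) = (- b * cnj
  \<beta> + d) * (1 - cnj (\<sigma> \<beta>) * z)\<close>.\<close>

lemma lf_op_kernel:
  assumes "linear_fractional_selfmap a b c d" "\<beta> \<in> \<U>"
  shows "lf_op a b c d (H2_kernel \<beta>) =
    (\<lambda>z. d / (- b * cnj \<beta> + d) *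
      H2_kernel (linear_fractional (cnj a) (- cnj c) (- cnj b) (cnj d) \<beta>) z)"
proof
  fix z
  define \<gamma> where "\<gamma> = linear_fractional (cnj a) (- cnj c) (- cnj b) (cnj d) \<beta>"
  note dual = linear_fractional_selfmap_dual[OF assms(1)]
  have \<gamma>: "\<gamma> \<in> \<U>"
    unfolding \<gamma>_def by (rule linear_fractional_selfmapD(3)[OF dual assms(2)])
  \<comment> \<open>This number is the conjugate of the denominator of \<sigma> at \<beta>.\<close>
  have nz1: "- b * cnj \<beta> + d \<noteq> 0"
  proof
    assume "- b * cnj \<beta> + d = 0"
    then have "cnj (- b * cnj \<beta> + d) = 0"
      by simp
    then show False
      using linear_fractional_selfmapD(2)[OF dual assms(2)] by simp
  qed
  have cnj_\<gamma>: "cnj \<gamma> * (- b * cnj \<beta> + d) = a * cnj \<beta> - c"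
    using nz1 by (simp add: \<gamma>_def linear_fractional_def)
  show "lf_op a b c d (H2_kernel \<beta>) z = d / (- b * cnj \<beta> + d) * H2_kernel \<gamma> z"
  proof (cases "z \<in> \<U>")
    case True
    define p where "p = linear_fractional a b c d z"
    have p: "p \<in> \<U>"
      unfolding p_def by (rule linear_fractional_selfmapD(3)[OF assms(1) True])
    have nz2: "c * z + d \<noteq> 0"
      by (rule linear_fractional_selfmapD(2)[OF assms(1) True])
    then have p_eq: "p * (c * z + d) = a * z + b"
      by (simp add: p_def linear_fractional_def)
    have "(c * z + d) * (1 - cnj \<beta> * p) = c * z + d - cnj \<beta> * (p * (c * z + d))"
      by (simp add: algebra_simps)
    also have "\<dots> = (- b * cnj \<beta> + d) - (cnj \<gamma> * (- b * cnj \<beta> + d)) * z"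
      unfolding p_eq cnj_\<gamma> by (simp add: algebra_simps)
    also have "\<dots> = (- b * cnj \<beta> + d) * (1 - cnj \<gamma> * z)"
      by (simp add: algebra_simps)
    finally have "d / ((c * z + d) * (1 - cnj \<beta> * p)) =
        d / ((- b * cnj \<beta> + d) * (1 - cnj \<gamma> * z))"
      by (rule arg_cong)
    then show ?thesis
      using True p by (simp add: lf_op_apply H2_kernel_def kernel_H2_def flip: p_def)
  qed (simp add: lf_op_apply H2_kernel_def)
qed

lemma lf_op_kernel_span:
  assumes "linear_fractional_selfmap a b c d" "f \<in> kernel_span"
  shows "lf_op a b c d f \<in> kernel_span"
  using assms(2)
proof induction
  case (scaled_kernel \<beta> k)
  then show ?case
    using linear_fractional_selfmapD(3)[OF linear_fractional_selfmap_dual[OF assms(1)]]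
    by (simp add: lf_op_cmult lf_op_kernel[OF assms(1)] kernel_span.scaled_kernel
        del: mult_minus_left times_divide_eq_left flip: mult.assoc)
next
  case (add f g)
  then show ?case
    by (simp add: lf_op_add kernel_span.add)
qed

text \<open>For a kernel at \<beta> both sides equal
  \<open>d / (c * \<beta> + d) * f (\<phi> \<beta>)\<close> by the reproducing property. Membership
  of the image in \<open>H2\<close> is assumed, since boundedness is proved only later and from this
  identity.\<close>

lemma lf_op_adjoint_span:
  assumes sm: "linear_fractional_selfmap a b c d"
    and f: "f \<in> H2" "lf_op a b c d f \<in> H2" and g: "g \<in> kernel_span"
  shows "H2_inner (lf_op a b c d f) g = H2_inner f (lf_adj a b c d g)"
  using g
proof induction
  case (scaled_kernel \<beta> k)
  have \<phi>: "linear_fractional a b c d \<beta> \<in> \<U>"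
    by (rule linear_fractional_selfmapD(3)[OF sm scaled_kernel])
  have "H2_inner f (lf_adj a b c d (H2_kernel \<beta>)) = d / (c * \<beta> + d) * f (linear_fractional a b c d \<beta>)"
    using lf_op_kernel[OF linear_fractional_selfmap_dual[OF sm] scaled_kernel] f \<phi>
    by (simp add: H2_inner_cmult_right H2_inner_kernel H2_kernel del: times_divide_eq_left)
  moreover have "lf_adj a b c d (H2_kernel \<beta>) \<in> H2"
    using kernel_span.scaled_kernel[OF scaled_kernel, of 1] kernel_span_subset_H2
      lf_op_kernel_span[OF linear_fractional_selfmap_dual[OF sm]] by auto
  ultimately show ?case
    using scaled_kernel f
    by (simp add: lf_op_cmult H2_inner_cmult_right H2_inner_kernel H2_kernel lf_op_apply)
next
  case (add g h)
  moreover have "lf_adj a b c d x \<in> H2" "x \<in> H2" if "x \<in> kernel_span" for x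
    using kernel_span_subset_H2 lf_op_kernel_span[OF linear_fractional_selfmap_dual[OF sm]] that by auto
  ultimately show ?case
    using f by (simp add: lf_op_add H2_inner_add_right)
qed

section \<open>Boundedness on the span through iterates of \<open>S W\<close>\<close>

definition lf_gram :: "complex \<Rightarrow> complex \<Rightarrow> complex \<Rightarrow> complex \<Rightarrow> operator"
  where "lf_gram a b c d f = lf_adj a b c d (lf_op a b c d f)"

text \<open>The new base point is \<open>\<gamma> = \<phi> (\<sigma> \<beta>)\<close>. One
  application costs at most a factor \<open>R\<close> in the coefficient and a factor \<kappa> in
  the distance to the circle, both independent of \<beta>, so the step can be iterated.\<close>

lemma lf_gram_kernel:
  assumes sm: "linear_fractional_selfmap a b c d"
  obtains R \<kappa> where "R > 0" "\<kappa> > 0"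
    "\<And>\<beta>. \<beta> \<in> \<U> \<Longrightarrow> \<exists>w \<gamma>. lf_gram a b c d (H2_kernel \<beta>) = (\<lambda>z. w * H2_kernel \<gamma> z) \<and>
      \<gamma> \<in> \<U> \<and> cmod w \<le> R \<and> \<kappa> * (1 - cmod \<beta>) \<le> 1 - cmod \<gamma>"
proof -
  let ?\<phi> = "linear_fractional a b c d"
  let ?\<sigma> = "linear_fractional (cnj a) (- cnj c) (- cnj b) (cnj d)"
  note dual = linear_fractional_selfmap_dual[OF sm]
  note less = linear_fractional_selfmap_norm_less[OF sm]
  obtain \<kappa>1 where \<kappa>1: "\<kappa>1 > 0" "\<And>z. z \<in> \<U> \<Longrightarrow> \<kappa>1 * (1 - cmod z) \<le> 1 - cmod (?\<phi> z)"
    using linear_fractional_selfmap_distance[OF sm] by blast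
  obtain \<kappa>2 where \<kappa>2: "\<kappa>2 > 0" "\<And>z. z \<in> \<U> \<Longrightarrow> \<kappa>2 * (1 - cmod z) \<le> 1 - cmod (?\<sigma> z)"
    using linear_fractional_selfmap_distance[OF dual] by blast
  define R where "R = (cmod d / (cmod d - cmod b)) * (cmod d / (cmod d - cmod c))"
  have d: "cmod d > 0"
    using less norm_ge_zero[of b] by linarith
  show thesis
  proof
    show "R > 0"
      using less d by (simp add: R_def)
    show "\<kappa>1 * \<kappa>2 > 0"
      using \<kappa>1 \<kappa>2 by simp
    fix \<beta> assume \<beta>: "\<beta> \<in> \<U>"
    define w1 w2 where "w1 = d / (- b * cnj \<beta> + d)" and "w2 = cnj d / (cnj c * cnj (?\<sigma> \<beta>) + cnj d)"
    have \<sigma>: "?\<sigma> \<beta> \<in> \<U>"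
      by (rule linear_fractional_selfmapD(3)[OF dual \<beta>])
    have "lf_gram a b c d (H2_kernel \<beta>) = (\<lambda>z. w1 * (w2 * H2_kernel (?\<phi> (?\<sigma> \<beta>)) z))"
      using lf_op_kernel[OF sm \<beta>] lf_op_kernel[OF dual \<sigma>]
      by (simp add: lf_gram_def lf_op_cmult w1_def w2_def
          del: times_divide_eq_left times_divide_eq_right)
    moreover have "cmod w1 \<le> cmod d / (cmod d - cmod b)"
      unfolding w1_def using cmod_divide_affine_le[of "- b" d "cnj \<beta>"] less \<beta> by simp
    moreover have "cmod w2 \<le> cmod d / (cmod d - cmod c)"
      unfolding w2_def using cmod_divide_affine_le[of "cnj c" "cnj d" "cnj (?\<sigma> \<beta>)"] less \<sigma> by simp
    ultimately have "lf_gram a b c d (H2_kernel \<beta>) = (\<lambda>z. w1 * w2 * H2_kernel (?\<phi> (?\<sigma> \<beta>)) z)"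
      "cmod (w1 * w2) \<le> R"
      using mult_mono[of "cmod w1" "cmod d / (cmod d - cmod b)"
          "cmod w2" "cmod d / (cmod d - cmod c)"] less d
      by (simp_all add: R_def norm_mult mult.assoc)
    moreover have "\<kappa>1 * \<kappa>2 * (1 - cmod \<beta>) \<le> 1 - cmod (?\<phi> (?\<sigma> \<beta>))"
      using order_trans[OF mult_left_mono[OF \<kappa>2(2)[OF \<beta>], of \<kappa>1] \<kappa>1(2)[OF \<sigma>]] \<kappa>1(1)
      by (simp add: mult.assoc)
    ultimately show "\<exists>w \<gamma>. lf_gram a b c d (H2_kernel \<beta>) = (\<lambda>z. w * H2_kernel \<gamma> z) \<and>
      \<gamma> \<in> \<U> \<and> cmod w \<le> R \<and> \<kappa>1 * \<kappa>2 * (1 - cmod \<beta>) \<le> 1 - cmod \<gamma>"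
      using linear_fractional_selfmapD(3)[OF sm \<sigma>] by blast
  qed
qed

lemma lf_gram_cmult: "lf_gram a b c d (\<lambda>z. k * f z) = (\<lambda>z. k * lf_gram a b c d f z)"
  by (simp add: lf_gram_def lf_op_cmult)

lemma lf_gram_power_add:
  "(lf_gram a b c d ^^ n) (\<lambda>z. f z + g z) =
    (\<lambda>z. (lf_gram a b c d ^^ n) f z + (lf_gram a b c d ^^ n) g z)"
  by (induction n) (simp_all add: lf_gram_def lf_op_add)

lemma lf_gram_power_span:
  assumes "linear_fractional_selfmap a b c d" "f \<in> kernel_span"
  shows "(lf_gram a b c d ^^ n) f \<in> kernel_span"
  by (induction n)
    (simp_all add: assms lf_gram_def lf_op_kernel_span linear_fractional_selfmap_dual)

text \<open>After \<open>n\<close> steps a kernel has coefficient of order \<open>R ^ n\<close> and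
  a base point at distance at least of order \<open>\<kappa> ^ n\<close> from the circle, hence
  \<open>L = R / \<kappa>\<close>. Only \<open>C\<close> depends on \<open>f\<close>.\<close>

lemma lf_gram_power_growth:
  assumes sm: "linear_fractional_selfmap a b c d"
  obtains L where "L > 0"
    "\<And>f. f \<in> kernel_span \<Longrightarrow> \<exists>C. \<forall>n. H2_norm ((lf_gram a b c d ^^ n) f) \<le> C * L ^ n"
proof -
  let ?T = "lf_gram a b c d"
  obtain R \<kappa> where R: "R > 0" and \<kappa>: "\<kappa> > 0" and ker:
    "\<And>\<beta>. \<beta> \<in> \<U> \<Longrightarrow> \<exists>w \<gamma>. ?T (H2_kernel \<beta>) = (\<lambda>z. w * H2_kernel \<gamma> z) \<and>
      \<gamma> \<in> \<U> \<and> cmod w \<le> R \<and> \<kappa> * (1 - cmod \<beta>) \<le> 1 - cmod \<gamma>"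
    using lf_gram_kernel[OF sm] by blast
  have "\<exists>C. \<forall>n. H2_norm ((?T ^^ n) f) \<le> C * (R / \<kappa>) ^ n" if "f \<in> kernel_span" for f
    using that
  proof induction
    case (scaled_kernel \<beta> k)
    have power: "\<exists>w \<gamma>. (?T ^^ n) (\<lambda>z. k * H2_kernel \<beta> z) = (\<lambda>z. w * H2_kernel \<gamma> z) \<and> \<gamma> \<in> \<U> \<and>
        cmod w \<le> cmod k * R ^ n \<and> \<kappa> ^ n * (1 - cmod \<beta>) \<le> 1 - cmod \<gamma>" for n
    proof (induction n)
      case 0
      then show ?case using scaled_kernel by auto
    next
      case (Suc n)
      then obtain w \<gamma> where IH: "(?T ^^ n) (\<lambda>z. k * H2_kernel \<beta> z) = (\<lambda>z. w * H2_kernel \<gamma> z)"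
        "\<gamma> \<in> \<U>" "cmod w \<le> cmod k * R ^ n" "\<kappa> ^ n * (1 - cmod \<beta>) \<le> 1 - cmod \<gamma>"
        by blast
      obtain v \<delta> where *: "?T (H2_kernel \<gamma>) = (\<lambda>z. v * H2_kernel \<delta> z)"
        "\<delta> \<in> \<U>" "cmod v \<le> R" "\<kappa> * (1 - cmod \<gamma>) \<le> 1 - cmod \<delta>"
        using ker[OF IH(2)] by blast
      have "(?T ^^ Suc n) (\<lambda>z. k * H2_kernel \<beta> z) = (\<lambda>z. w * v * H2_kernel \<delta> z)"
        using IH(1) *(1) by (simp add: lf_gram_cmult mult.assoc)
      moreover have "cmod (w * v) \<le> cmod k * R ^ Suc n"
        using mult_mono[OF IH(3) *(3)] R by (simp add: norm_mult mult_ac)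
      moreover have "\<kappa> ^ Suc n * (1 - cmod \<beta>) \<le> 1 - cmod \<delta>"
        using order_trans[OF mult_left_mono[OF IH(4), of \<kappa>] *(4)] \<kappa> by (simp add: mult.assoc)
      ultimately show ?case
        using *(2) by blast
    qed
    have "H2_norm ((?T ^^ n) (\<lambda>z. k * H2_kernel \<beta> z))
        \<le> cmod k / (1 - cmod \<beta>) * (R / \<kappa>) ^ n" for n
    proof -
      obtain w \<gamma> where *: "(?T ^^ n) (\<lambda>z. k * H2_kernel \<beta> z) = (\<lambda>z. w * H2_kernel \<gamma> z)"
        "\<gamma> \<in> \<U>" "cmod w \<le> cmod k * R ^ n" "\<kappa> ^ n * (1 - cmod \<beta>) \<le> 1 - cmod \<gamma>"
        using power by blast
      have "H2_norm ((?T ^^ n) (\<lambda>z. k * H2_kernel \<beta> z)) \<le> cmod w * (1 / (1 - cmod \<gamma>))"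
        unfolding *(1) H2_cmult(2)[OF H2_kernel(1)[OF *(2)]]
        by (intro mult_left_mono H2_kernel *) auto
      also have "\<dots> \<le> (cmod k * R ^ n) * (1 / (\<kappa> ^ n * (1 - cmod \<beta>)))"
        using * \<kappa> R scaled_kernel by (intro mult_mono divide_left_mono) auto
      finally show ?thesis
        by (simp add: power_divide mult.commute)
    qed
    then show ?case by blast
  next
    case (add f g)
    then obtain C D where CD: "\<And>n. H2_norm ((?T ^^ n) f) \<le> C * (R / \<kappa>) ^ n"
      "\<And>n. H2_norm ((?T ^^ n) g) \<le> D * (R / \<kappa>) ^ n"
      by blast
    have "H2_norm ((?T ^^ n) (\<lambda>z. f z + g z)) \<le> (C + D) * (R / \<kappa>) ^ n" for n
    proof -
      have "(?T ^^ n) f \<in> H2" "(?T ^^ n) g \<in> H2"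
        using lf_gram_power_span[OF sm] add kernel_span_subset_H2 by blast+
      then show ?thesis
        using H2_add(2)[of "(?T ^^ n) f" "(?T ^^ n) g"] CD[of n]
        by (simp add: lf_gram_power_add distrib_right)
    qed
    then show ?case by blast
  qed
  then show thesis
    using that[of "R / \<kappa>"] R \<kappa> by simp
qed

text \<open>Log-convexity makes successive ratios increase. If the first ratio \<open>q\<close>
  exceeded \<open>L\<close>, then \<open>x n \<ge> q ^ n * x 0\<close> would outgrow
  \<open>C * L ^ n\<close>; the constant \<open>C\<close> disappears from the conclusion.\<close>

lemma log_convex_exponential_bound:
  fixes x :: "nat \<Rightarrow> real"
  assumes nonneg: "\<And>n. x n \<ge> 0" and convex: "\<And>n. (x (Suc n))\<^sup>2 \<le> x n * x (Suc (Suc n))"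
    and bound: "\<And>n. x n \<le> C * L ^ n" and L: "L > 0"
  shows "x 1 \<le> L * x 0"
proof (rule ccontr)
  assume "\<not> x 1 \<le> L * x 0"
  then have gt: "x 1 > L * x 0"
    by simp
  \<comment> \<open>If \<open>x 0 = 0\<close>, convexity forces \<open>x 1 = 0\<close>, against
    \<open>gt\<close>.\<close>
  have x0: "x 0 > 0"
    using convex[of 0] nonneg[of 0] gt L by (cases "x 0 = 0") auto
  define q where "q = x 1 / x 0"
  have q: "q > L"
    using gt x0 by (simp add: q_def field_simps)
  have step: "x n > 0 \<and> q * x n \<le> x (Suc n)" for n
  proof (induction n)
    case 0
    then show ?case using x0 by (simp add: q_def)
  next
    case (Suc n)
    have pos: "x (Suc n) > 0"
      using Suc q L by (smt (verit) mult_pos_pos)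
    have "x n * (q * x (Suc n)) = (q * x n) * x (Suc n)"
      by simp
    also have "\<dots> \<le> x (Suc n) * x (Suc n)"
      using Suc pos by (intro mult_right_mono) auto
    also have "\<dots> \<le> x n * x (Suc (Suc n))"
      using convex[of n] by (simp add: power2_eq_square)
    finally show ?case
      using pos Suc by simp
  qed
  have "q ^ n * x 0 \<le> x n" for n
  proof (induction n)
    case (Suc n)
    then have "q ^ Suc n * x 0 \<le> q * x n"
      using q L by (simp add: mult.assoc)
    then show ?case
      using step[of n] by linarith
  qed simp
  then have "q ^ n * x 0 \<le> C * L ^ n" for n
    using bound order_trans by blast
  then have "(q / L) ^ n \<le> C / x 0" for n
    using x0 L by (simp add: power_divide field_simps)
  moreover obtain n where "C / x 0 < (q / L) ^ n"
    using real_arch_pow[of "q / L"] q L by auto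
  ultimately show False
    by (meson not_less)
qed

lemma lf_op_bounded_span:
  assumes sm: "linear_fractional_selfmap a b c d"
  obtains M where "M \<ge> 0" "\<And>f. f \<in> kernel_span \<Longrightarrow> H2_norm (lf_op a b c d f) \<le> M * H2_norm f"
proof -
  let ?T = "lf_gram a b c d"
  note dual = linear_fractional_selfmap_dual[OF sm]
  obtain L where L: "L > 0"
    "\<And>f. f \<in> kernel_span \<Longrightarrow> \<exists>C. \<forall>n. H2_norm ((?T ^^ n) f) \<le> C * L ^ n"
    using lf_gram_power_growth[OF sm] by blast
  have H2: "f \<in> H2" "lf_op a b c d f \<in> H2" "lf_op a b c d f \<in> kernel_span" "?T f \<in> H2"
    "?T f \<in> kernel_span" if "f \<in> kernel_span" for f
    using that lf_op_kernel_span[OF sm] lf_op_kernel_span[OF dual] kernel_span_subset_H2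
    by (auto simp: lf_gram_def)
  have adj: "H2_inner (lf_op a b c d f) (lf_op a b c d g) = H2_inner f (?T g)"
    if "f \<in> kernel_span" "g \<in> kernel_span" for f g
    using lf_op_adjoint_span[OF sm] that H2 by (simp add: lf_gram_def)
  \<comment> \<open>The adjoint identity for the dual map leads from \<open>S\<close> back to
    \<open>W\<close>, so both sides equal the inner product of \<open>W f\<close> and
    \<open>W g\<close>.\<close>
  have sym: "H2_inner (?T f) g = H2_inner f (?T g)"
    if "f \<in> kernel_span" "g \<in> kernel_span" for f g
    using lf_op_adjoint_span[OF dual, of "lf_op a b c d f" g] that H2 adj by (simp add: lf_gram_def)
  show thesis
  proof
    \<comment> \<open>The root appears because \<open>L\<close> bounds \<open>S W\<close>, which
      controls the square of the norm of \<open>W f\<close>.\<close>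
    show "sqrt L \<ge> 0"
      using L by simp
    fix f assume f: "f \<in> kernel_span"
    define x where "x n = H2_norm ((?T ^^ n) f)" for n
    note span = lf_gram_power_span[OF sm f]
    obtain C where C: "\<And>n. x n \<le> C * L ^ n"
      using L(2)[OF f] by (auto simp: x_def)
    \<comment> \<open>Symmetry moves one factor \<open>?T\<close> to the right-hand slot;
      Cauchy-Schwarz then compares the iterates \<open>n\<close> and \<open>n + 2\<close>.\<close>
    have "(x (Suc n))\<^sup>2 \<le> x n * x (Suc (Suc n))" for n
    proof -
      have "complex_of_real ((x (Suc n))\<^sup>2) = H2_inner (?T ((?T ^^ n) f)) (?T ((?T ^^ n) f))"
        using H2[OF span] by (simp add: x_def H2_inner_self)
      also have "\<dots> = H2_inner ((?T ^^ n) f) (?T (?T ((?T ^^ n) f)))"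
        by (rule sym[OF span H2(5)[OF span]])
      finally have "(x (Suc n))\<^sup>2 = cmod (H2_inner ((?T ^^ n) f) (?T (?T ((?T ^^ n) f))))"
        by (metis norm_of_real abs_of_nonneg zero_le_power2)
      also have "\<dots> \<le> x n * x (Suc (Suc n))"
        using H2_inner_Cauchy_Schwarz[OF H2(1)[OF span] H2(4)[OF H2(5)[OF span]]]
        by (simp add: x_def)
      finally show ?thesis .
    qed
    then have "x 1 \<le> L * x 0"
      using C L(1) H2(1)[OF span] by (intro log_convex_exponential_bound[of x]) (auto simp: x_def H2_norm_nonneg)
    then have T: "H2_norm (?T f) \<le> L * H2_norm f"
      by (simp add: x_def)
    have "complex_of_real ((H2_norm (lf_op a b c d f))\<^sup>2) = H2_inner f (?T f)"
      using adj[OF f f] H2[OF f] by (simp add: H2_inner_self)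
    then have "(H2_norm (lf_op a b c d f))\<^sup>2 = cmod (H2_inner f (?T f))"
      by (metis norm_of_real abs_of_nonneg zero_le_power2)
    also have "\<dots> \<le> H2_norm f * H2_norm (?T f)"
      by (intro H2_inner_Cauchy_Schwarz H2 f)
    also have "\<dots> \<le> H2_norm f * (L * H2_norm f)"
      by (intro mult_left_mono T H2_norm_nonneg H2 f)
    also have "\<dots> = (sqrt L * H2_norm f)\<^sup>2"
      using L(1) by (simp add: power_mult_distrib power2_eq_square)
    finally show "H2_norm (lf_op a b c d f) \<le> sqrt L * H2_norm f"
      by (rule power2_le_imp_le) (use L(1) H2_norm_nonneg[OF H2(1)[OF f]] in simp)
  qed
qed

section \<open>Extension from the span to the whole Hardy space\<close>

lemma le_by_linear_error:
  fixes x y K :: real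
  assumes "\<And>e. e > 0 \<Longrightarrow> x \<le> y + K * e" "K \<ge> 0"
  shows "x \<le> y"
proof (rule field_le_epsilon)
  fix e :: real assume e: "e > 0"
  \<comment> \<open>\<open>K + 1\<close> is positive even for \<open>K = 0\<close>.\<close>
  then have "x \<le> y + K * (e / (K + 1))"
    using assms by (intro assms(1)) auto
  also have "K * (e / (K + 1)) \<le> e"
    using assms(2) e by (simp add: field_simps)
  finally show "x \<le> y + e" by simp
qed

lemma lf_op_holomorphic:
  assumes sm: "linear_fractional_selfmap a b c d" and f: "f \<in> H2"
  shows "lf_op a b c d f holomorphic_on \<U>"
proof (rule holomorphic_transform)
  have "linear_fractional a b c d holomorphic_on \<U>"
    using linear_fractional_selfmapD(2)[OF sm]
    by (auto simp: linear_fractional_def[abs_def] intro!: holomorphic_intros)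
  then have "(f \<circ> linear_fractional a b c d) holomorphic_on \<U>"
    using linear_fractional_selfmapD(3)[OF sm]
    by (intro holomorphic_on_compose_gen[OF _ H2D(1)[OF f]]) auto
  moreover have "(\<lambda>z. d / (c * z + d)) holomorphic_on \<U>"
    using linear_fractional_selfmapD(2)[OF sm] by (intro holomorphic_intros) auto
  ultimately show "(\<lambda>z. d / (c * z + d) * (f \<circ> linear_fractional a b c d) z) holomorphic_on \<U>"
    by (rule holomorphic_on_mult[rotated])
qed (simp add: lf_op_apply)

text \<open>Each coefficient of \<open>W f\<close> depends continuously on \<open>f\<close>, by
  Cauchy's estimate on the circle of radius 1/2. The factor \<open>2 ^ n\<close> is harmless because
  only finitely many coefficients are used at a time.\<close>

lemma lf_op_maclaurin_bound:
  assumes sm: "linear_fractional_selfmap a b c d"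
  obtains K where "K \<ge> 0"
    "\<And>f n. f \<in> H2 \<Longrightarrow> cmod (maclaurin (lf_op a b c d f) n) \<le> K * 2 ^ n * H2_norm f"
proof -
  let ?\<phi> = "linear_fractional a b c d"
  note less = linear_fractional_selfmap_norm_less[OF sm]
  obtain \<kappa> where \<kappa>: "\<kappa> > 0" "\<And>z. z \<in> \<U> \<Longrightarrow> \<kappa> * (1 - cmod z) \<le> 1 - cmod (?\<phi> z)"
    using linear_fractional_selfmap_distance[OF sm] by blast
  define R where "R = cmod d / (cmod d - cmod c)"
  have R: "R \<ge> 0"
    using less by (simp add: R_def)
  show thesis
  proof
    show "R * (2 / \<kappa>) \<ge> 0"
      using R \<kappa> by simp
    fix f n assume f: "f \<in> H2"
    \<comment> \<open>On this circle \<open>1 - cmod (\<phi> z)\<close> is at least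
      \<open>\<kappa> / 2\<close>, so evaluation at \<open>\<phi> z\<close> is uniformly
      bounded.\<close>
    have "cmod (lf_op a b c d f z) \<le> R * (H2_norm f / (\<kappa> / 2))" if z: "cmod z = 1 / 2" for z
    proof -
      have zU: "z \<in> \<U>"
        using z by simp
      note \<phi> = linear_fractional_selfmapD(3)[OF sm zU]
      have "cmod (f (?\<phi> z)) \<le> H2_norm f / (1 - cmod (?\<phi> z))"
        by (rule H2_eval_bound[OF f \<phi>])
      also have "\<dots> \<le> H2_norm f / (\<kappa> / 2)"
        using \<kappa>(1) \<kappa>(2)[OF zU] \<phi> z H2_norm_nonneg[OF f] by (intro divide_left_mono) auto
      finally have "cmod (f (?\<phi> z)) \<le> H2_norm f / (\<kappa> / 2)" .
      moreover have "cmod (d / (c * z + d)) \<le> R"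
        unfolding R_def using less zU by (intro cmod_divide_affine_le) auto
      ultimately show ?thesis
        unfolding lf_op_apply(1)[OF zU] norm_mult using R by (intro mult_mono) auto
    qed
    from maclaurin_bound[OF lf_op_holomorphic[OF sm f] _ _ this, of "1 / 2"]
    show "cmod (maclaurin (lf_op a b c d f) n) \<le> R * (2 / \<kappa>) * 2 ^ n * H2_norm f"
      by (simp add: power_divide mult_ac)
  qed
qed

text \<open>For fixed \<open>J\<close>, split \<open>f\<close> into \<open>g\<close> in the span and
  a small remainder \<open>h\<close>. The first \<open>J\<close> coefficients of \<open>W g\<close>
  obey the bound on the span, those of \<open>W h\<close> the coefficient estimate. As
  \<open>M\<close> does not depend on \<open>J\<close>, \<open>H2I\<close> applies.\<close>

lemma lf_op_bounded:
  assumes sm: "linear_fractional_selfmap a b c d"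
  obtains M where "M \<ge> 0" "\<And>f. f \<in> H2 \<Longrightarrow> lf_op a b c d f \<in> H2"
    "\<And>f. f \<in> H2 \<Longrightarrow> H2_norm (lf_op a b c d f) \<le> M * H2_norm f"
proof -
  let ?W = "lf_op a b c d"
  obtain M where M: "M \<ge> 0" "\<And>f. f \<in> kernel_span \<Longrightarrow> H2_norm (?W f) \<le> M * H2_norm f"
    using lf_op_bounded_span[OF sm] by blast
  obtain K where K: "K \<ge> 0"
    "\<And>f n. f \<in> H2 \<Longrightarrow> cmod (maclaurin (?W f) n) \<le> K * 2 ^ n * H2_norm f"
    using lf_op_maclaurin_bound[OF sm] by blast
  have "L2_set (\<lambda>n. cmod (maclaurin (?W f) n)) {..<J} \<le> M * H2_norm f" if f: "f \<in> H2" for f J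
  proof (rule le_by_linear_error)
    \<comment> \<open>This factor of the error depends on \<open>J\<close>, which stays fixed while
      \<open>e\<close> tends to 0.\<close>
    show "M + (\<Sum>n<J. K * 2 ^ n) \<ge> 0"
      using M(1) K(1) by (intro add_nonneg_nonneg sum_nonneg) auto
    fix e :: real assume e: "e > 0"
    obtain g where g: "g \<in> kernel_span" "g \<in> H2" "H2_norm (\<lambda>z. f z - g z) < e"
      using kernel_closureE[OF H2_kernel_closure[OF f] e] .
    define h where "h = (\<lambda>z. f z - g z)"
    have h: "h \<in> H2" "H2_norm h < e"
      using g H2_diff[OF f g(2)] by (auto simp: h_def)
    have Wg: "?W g \<in> H2"
      using lf_op_kernel_span[OF sm g(1)] kernel_span_subset_H2 by blast
    have split: "?W f = (\<lambda>z. ?W g z + ?W h z)"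
      by (simp add: h_def lf_op_diff)
    have "L2_set (\<lambda>n. cmod (maclaurin (?W f) n)) {..<J}
      \<le> L2_set (\<lambda>n. cmod (maclaurin (?W g) n) + cmod (maclaurin (?W h) n)) {..<J}"
      unfolding split maclaurin_add[OF H2D(1)[OF Wg] lf_op_holomorphic[OF sm h(1)]]
      by (intro L2_set_mono) (auto simp: norm_triangle_ineq)
    also have "\<dots> \<le> L2_set (\<lambda>n. cmod (maclaurin (?W g) n)) {..<J}
      + L2_set (\<lambda>n. cmod (maclaurin (?W h) n)) {..<J}"
      by (rule L2_set_triangle_ineq)
    also have "L2_set (\<lambda>n. cmod (maclaurin (?W g) n)) {..<J} \<le> M * H2_norm g"
      using L2_set_maclaurin_le[OF Wg] M(2)[OF g(1)] order_trans by blast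
    also have "M * H2_norm g \<le> M * (H2_norm f + e)"
      using H2_norm_triangle_sub[OF g(2) f] H2_norm_diff_commute[OF f g(2)] g(3) M(1)
      by (intro mult_left_mono) auto
    also have "L2_set (\<lambda>n. cmod (maclaurin (?W h) n)) {..<J} \<le> (\<Sum>n<J. cmod (maclaurin (?W h) n))"
      using L2_set_le_sum_abs[of "\<lambda>n. cmod (maclaurin (?W h) n)" "{..<J}"] by simp
    also have "\<dots> \<le> (\<Sum>n<J. K * 2 ^ n * H2_norm h)"
      by (intro sum_mono K h)
    also have "\<dots> \<le> (\<Sum>n<J. K * 2 ^ n * e)"
      using h(2) K(1) by (intro sum_mono mult_left_mono) auto
    finally show "L2_set (\<lambda>n. cmod (maclaurin (?W f) n)) {..<J}
        \<le> M * H2_norm f + (M + (\<Sum>n<J. K * 2 ^ n)) * e"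
      by (simp add: algebra_simps sum_distrib_left sum_distrib_right)
  qed
  then have "?W f \<in> H2" "H2_norm (?W f) \<le> M * H2_norm f" if "f \<in> H2" for f
    using H2I[OF lf_op_holomorphic[OF sm that], of "M * H2_norm f"] that
    by (auto simp: lf_op_apply)
  then show thesis
    using that M(1) by blast
qed

lemma bounded_operator_lf_op:
  assumes "linear_fractional_selfmap a b c d"
  shows "bounded_operator_H2 (lf_op a b c d)"
proof -
  obtain M where "M \<ge> 0" "\<And>f. f \<in> H2 \<Longrightarrow> lf_op a b c d f \<in> H2"
    "\<And>f. f \<in> H2 \<Longrightarrow> H2_norm (lf_op a b c d f) \<le> M * H2_norm f"
    using lf_op_bounded[OF assms] by blast
  then show ?thesis
    by (auto simp: bounded_operator_H2_def lf_op_add lf_op_cmult)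
qed

text \<open>Approximate \<open>g\<close> by \<open>h\<close> in the span. The identity is exact for
  \<open>h\<close>; for the remainder both sides are small by Cauchy-Schwarz and boundedness of
  \<open>S\<close>.\<close>

lemma lf_op_adjoint:
  assumes sm: "linear_fractional_selfmap a b c d" and f: "f \<in> H2" and g: "g \<in> H2"
  shows "H2_inner (lf_op a b c d f) g = H2_inner f (lf_adj a b c d g)"
proof -
  let ?W = "lf_op a b c d" and ?S = "lf_adj a b c d"
  note dual = linear_fractional_selfmap_dual[OF sm]
  obtain M where M: "M \<ge> 0" "\<And>f. f \<in> H2 \<Longrightarrow> ?S f \<in> H2"
    "\<And>f. f \<in> H2 \<Longrightarrow> H2_norm (?S f) \<le> M * H2_norm f"
    using lf_op_bounded[OF dual] by blast
  have Wf: "?W f \<in> H2"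
    using lf_op_bounded[OF sm] f by blast
  note nonneg = H2_norm_nonneg[OF Wf] H2_norm_nonneg[OF f]
  have "cmod (H2_inner (?W f) g - H2_inner f (?S g)) \<le> 0"
  proof (rule le_by_linear_error)
    show "H2_norm (?W f) + H2_norm f * M \<ge> 0"
      using nonneg M(1) by simp
    fix e :: real assume e: "e > 0"
    obtain h where h: "h \<in> kernel_span" "h \<in> H2" "H2_norm (\<lambda>z. g z - h z) < e"
      using kernel_closureE[OF H2_kernel_closure[OF g] e] .
    define r where "r = (\<lambda>z. g z - h z)"
    have r: "r \<in> H2" "H2_norm r < e"
      using h H2_diff[OF g h(2)] by (auto simp: r_def)
    have "H2_inner (?W f) h = H2_inner f (?S h)"
      by (rule lf_op_adjoint_span[OF sm f Wf h(1)])
    then have "H2_inner (?W f) g - H2_inner f (?S g) = H2_inner (?W f) r - H2_inner f (?S r)"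
      using M(2) Wf f g h(2) by (simp add: r_def lf_op_diff H2_inner_diff_right)
    then have "cmod (H2_inner (?W f) g - H2_inner f (?S g))
        \<le> cmod (H2_inner (?W f) r) + cmod (H2_inner f (?S r))"
      by (simp only: norm_triangle_ineq4)
    also have "\<dots> \<le> H2_norm (?W f) * H2_norm r + H2_norm f * H2_norm (?S r)"
      by (rule add_mono[OF H2_inner_Cauchy_Schwarz[OF Wf r(1)]
            H2_inner_Cauchy_Schwarz[OF f M(2)[OF r(1)]]])
    also have "\<dots> \<le> H2_norm (?W f) * e + H2_norm f * (M * e)"
    proof (intro add_mono mult_left_mono nonneg)
      show "H2_norm r \<le> e"
        using r(2) by simp
      have "H2_norm (?S r) \<le> M * H2_norm r"
        by (rule M(3)[OF r(1)])
      also have "\<dots> \<le> M * e"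
        using r(2) M(1) by (intro mult_left_mono) auto
      finally show "H2_norm (?S r) \<le> M * e" .
    qed
    finally show "cmod (H2_inner (?W f) g - H2_inner f (?S g))
        \<le> 0 + (H2_norm (?W f) + H2_norm f * M) * e"
      by (simp add: algebra_simps)
  qed
  then show ?thesis by simp
qed

section \<open>Normality as commutation with the adjoint\<close>

lemma H2_eqI:
  assumes "f \<in> H2" "g \<in> H2" "\<And>h. h \<in> H2 \<Longrightarrow> H2_inner h f = H2_inner h g"
  shows "f = g"
proof
  fix z
  show "f z = g z"
  proof (cases "z \<in> \<U>")
    case True
    \<comment> \<open>Testing against the kernel at \<open>z\<close> recovers the value at
      \<open>z\<close>.\<close>
    have "H2_inner f (H2_kernel z) = H2_inner g (H2_kernel z)"
      using assms H2_kernel(1)[OF True] by (simp add: H2_inner_commute[of "H2_kernel z"])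
    then show ?thesis
      using True assms by (simp add: H2_inner_kernel)
  qed (use assms in \<open>simp add: H2D\<close>)
qed

text \<open>Any adjoint agrees with \<open>lf_adj\<close> on \<open>H2\<close>, so the existential
  in \<open>normal_H2\<close> reduces to this one witness. Since \<open>W\<close> preserves
  \<open>H2\<close>, the replacement is also valid at \<open>W f\<close>.\<close>

lemma normal_lf_op_iff:
  assumes sm: "linear_fractional_selfmap a b c d"
  shows "normal_H2 (lf_op a b c d) \<longleftrightarrow>
    (\<forall>f\<in>H2. lf_op a b c d (lf_adj a b c d f) = lf_adj a b c d (lf_op a b c d f))"
proof -
  let ?W = "lf_op a b c d" and ?S = "lf_adj a b c d"
  have W: "bounded_operator_H2 ?W" and S: "bounded_operator_H2 ?S"
    using bounded_operator_lf_op sm linear_fractional_selfmap_dual by blast+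
  have H2: "?W f \<in> H2" "?S f \<in> H2" if "f \<in> H2" for f
    using W S that by (auto simp: bounded_operator_H2_def)
  have adj: "adjoint_H2 ?W ?S"
    using S lf_op_adjoint[OF sm] by (simp add: adjoint_H2_def)
  have unique: "S' g = ?S g" if "adjoint_H2 ?W S'" "g \<in> H2" for S' g
    using that H2 lf_op_adjoint[OF sm] by (intro H2_eqI) (auto simp: adjoint_H2_def bounded_operator_H2_def)
  show ?thesis
  proof
    assume "normal_H2 ?W"
    then obtain S' where S': "adjoint_H2 ?W S'" "\<forall>f\<in>H2. ?W (S' f) = S' (?W f)"
      by (auto simp: normal_H2_def)
    then show "\<forall>f\<in>H2. ?W (?S f) = ?S (?W f)"
      using H2 by (simp add: unique[OF S'(1)])
  next
    assume "\<forall>f\<in>H2. ?W (?S f) = ?S (?W f)"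
    then show "normal_H2 ?W"
      using W adj by (auto simp: normal_H2_def)
  qed
qed

theorem proposition12:
  fixes a b c d :: complex and \<phi> \<sigma> \<psi> :: "complex \<Rightarrow> complex"
  assumes "linear_fractional_selfmap a b c d"
    and "\<phi> = linear_fractional a b c d"
    and "\<sigma> = linear_fractional (cnj a) (- cnj c) (- cnj b) (cnj d)"
    and "\<psi> = kernel_H2 (\<sigma> 0)"
  shows "normal_H2 (weighted_comp \<psi> \<phi>) \<longleftrightarrow>
    (\<forall>f\<in>H2.
      weighted_comp
        (\<lambda>z. complex_of_real ((cmod d)\<^sup>2) /
          (complex_of_real ((cmod d)\<^sup>2 - (cmod b)\<^sup>2) - (cnj b * a - cnj d * c) * z))
        (\<sigma> \<circ> \<phi>) f =
      weighted_comp
        (\<lambda>z. complex_of_real ((cmod d)\<^sup>2) /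
          (complex_of_real ((cmod d)\<^sup>2 - (cmod c)\<^sup>2) - (cnj b * d - c * cnj a) * z))
        (\<phi> \<circ> \<sigma>) f)"
proof -
  note sm = assms(1)
  note dual = linear_fractional_selfmap_dual[OF sm]
  have d: "d \<noteq> 0"
    using linear_fractional_selfmapD(2)[OF sm, of 0] by simp
  \<comment> \<open>Here \<open>cnj (\<sigma> 0) = - c / d\<close>.\<close>
  have "\<psi> = (\<lambda>z. d / (c * z + d))"
  proof
    fix z
    have "\<psi> z = 1 / (1 + c / d * z)"
      by (simp add: assms(3,4) kernel_H2_def linear_fractional_def)
    also have "1 + c / d * z = (c * z + d) / d"
      using d by (simp add: add_divide_distrib)
    finally show "\<psi> z = d / (c * z + d)" by simp
  qed
  then have W: "weighted_comp \<psi> \<phi> = lf_op a b c d"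
    by (simp add: lf_op_def assms(2))
  \<comment> \<open>The weights multiply to a quotient with denominator
    \<open>(c * z + d) * (- cnj b * \<phi> z + cnj d)\<close>. The first factor clears the
    denominator of \<open>\<phi> z\<close>, which leaves the displayed affine function.\<close>
  have WS: "lf_op a b c d (lf_adj a b c d f) =
      weighted_comp
        (\<lambda>z. complex_of_real ((cmod d)\<^sup>2) /
          (complex_of_real ((cmod d)\<^sup>2 - (cmod b)\<^sup>2) - (cnj b * a - cnj d * c) * z))
        (\<sigma> \<circ> \<phi>) f" for f
  proof
    fix z
    show "lf_op a b c d (lf_adj a b c d f) z =
      weighted_comp
        (\<lambda>z. complex_of_real ((cmod d)\<^sup>2) /
          (complex_of_real ((cmod d)\<^sup>2 - (cmod b)\<^sup>2) - (cnj b * a - cnj d * c) * z))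
        (\<sigma> \<circ> \<phi>) f z"
    proof (cases "z \<in> \<U>")
      case True
      note \<phi> = linear_fractional_selfmapD(3)[OF sm True]
      have "(c * z + d) * (- cnj b * \<phi> z + cnj d) = cnj d * (c * z + d) - cnj b * (a * z + b)"
      proof -
        have "\<phi> z * (c * z + d) = a * z + b"
          using linear_fractional_selfmapD(2)[OF sm True]
          by (simp add: assms(2) linear_fractional_def)
        then have "cnj b * (a * z + b) = cnj b * (\<phi> z * (c * z + d))"
          by simp
        then show ?thesis
          by (simp add: algebra_simps)
      qed
      also have "\<dots> = complex_of_real ((cmod d)\<^sup>2 - (cmod b)\<^sup>2) - (cnj b * a - cnj d * c) * z"
        by (simp add: complex_norm_square algebra_simps del: of_real_power)
      finally have eq: "(c * z + d) * (- cnj b * \<phi> z + cnj d) = \<dots>" .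
      have "lf_op a b c d (lf_adj a b c d f) z
          = (d * cnj d) / ((c * z + d) * (- cnj b * \<phi> z + cnj d)) * f (\<sigma> (\<phi> z))"
        using \<phi> True by (simp add: lf_op_apply assms(2,3))
      then show ?thesis
        using True by (simp only: eq weighted_comp_def complex_norm_square if_True o_apply)
    qed (simp add: lf_op_apply weighted_comp_def)
  qed
  \<comment> \<open>The same computation with \<phi> and \<sigma> exchanged: the factor
    \<open>- cnj b * z + cnj d\<close> clears the denominator of \<open>\<sigma> z\<close>.\<close>
  have SW: "lf_adj a b c d (lf_op a b c d f) =
      weighted_comp
        (\<lambda>z. complex_of_real ((cmod d)\<^sup>2) /
          (complex_of_real ((cmod d)\<^sup>2 - (cmod c)\<^sup>2) - (cnj b * d - c * cnj a) * z))
        (\<phi> \<circ> \<sigma>) f" for f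
  proof
    fix z
    show "lf_adj a b c d (lf_op a b c d f) z =
      weighted_comp
        (\<lambda>z. complex_of_real ((cmod d)\<^sup>2) /
          (complex_of_real ((cmod d)\<^sup>2 - (cmod c)\<^sup>2) - (cnj b * d - c * cnj a) * z))
        (\<phi> \<circ> \<sigma>) f z"
    proof (cases "z \<in> \<U>")
      case True
      note \<sigma> = linear_fractional_selfmapD(3)[OF dual True]
      have "(- cnj b * z + cnj d) * (c * \<sigma> z + d)
          = d * (- cnj b * z + cnj d) + c * (cnj a * z - cnj c)"
      proof -
        have "\<sigma> z * (- cnj b * z + cnj d) = cnj a * z - cnj c"
          unfolding assms(3) linear_fractional_def
          using linear_fractional_selfmapD(2)[OF dual True] by simp
        then have "c * (cnj a * z - cnj c) = c * (\<sigma> z * (- cnj b * z + cnj d))"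
          by simp
        then show ?thesis
          by (simp add: algebra_simps)
      qed
      also have "\<dots> = complex_of_real ((cmod d)\<^sup>2 - (cmod c)\<^sup>2) - (cnj b * d - c * cnj a) * z"
        by (simp add: complex_norm_square algebra_simps del: of_real_power)
      finally have eq: "(- cnj b * z + cnj d) * (c * \<sigma> z + d) = \<dots>" .
      have "lf_adj a b c d (lf_op a b c d f) z
          = (d * cnj d) / ((- cnj b * z + cnj d) * (c * \<sigma> z + d)) * f (\<phi> (\<sigma> z))"
        using \<sigma> True by (simp add: lf_op_apply assms(2,3) mult.commute)
      then show ?thesis
        using True by (simp only: eq weighted_comp_def complex_norm_square if_True o_apply)
    qed (simp add: lf_op_apply weighted_comp_def)
  qed
  show ?thesis
    unfolding W normal_lf_op_iff[OF sm] WS SW ..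
qed

end
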